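(* Let $W=(W_t)_{t\in[0,T]}$ be a $d$-dimensional Brownian motion. Let $p\in(2,3)$ and let $\mathcal{P}^n=\{0=t^n_0<t^n_1<\cdots<t^n_{N_n}=T\}$, $n\in\mathbb{N}$, be a sequence of equidistant partitions of the interval $[0,T]$, so that, for each $n\in\mathbb{N}$, there exists some $\pi_n>0$ such that $t^n_{i+1}-t^n_i=\pi_n$ for each $0\le i<N_n$. If $\pi_n^{2-\frac4p}\log(n)\to0$ as $n\to\infty$, then, for almost every $\omega\in\Omega$, the sample path $W(\omega)$ satisfies Property (RIE) relative to $p$ and $(\mathcal{P}^n)_{n\in\mathbb{N}}$.
   Context: $T>0$ is a fixed time horizon, and $W$ is a Brownian motion on a filtered probability space $(\Omega,\mathcal{F},(\mathcal{F}_t)_{t\in[0,T]},\mathbb{P})$ satisfying the usual conditions. Notation. $\Delta_T=\{(s,t)\in[0,T]^2:s\le t\}$; $X_{s,t}=X_t-X_s$; $x\otimes y=(x^iy^j)_{i,j}$; $|\mathcal{P}|=\max_i|u_{i+1}-u_i|$ is the mesh size of a partition. A control function is $w\colon\Delta_T\to[0,\infty)$ with $w(s,u)+w(u,t)\le w(s,t)$ for $s\le u\le t$. Convention: $\frac00:=0$. Property (RIE). Let $p\in(2,3)$ and let $\mathcal{P}^n=\{0=t^n_0<\cdots<t^n_{N_n}=T\}$ be a sequence of partitions of $[0,T]$ with $|\mathcal{P}^n|\to0$. For a càdlàg path $X\colon[0,T]\to\mathbb{R}^d$ put $X^n_t=X_T\mathbf{1}_{\{T\}}(t)+\sum_{k=0}^{N_n-1}X_{t^n_k}\mathbf{1}_{[t^n_k,t^n_{k+1})}(t)$.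 $X$ satisfies Property (RIE) relative to $p$ and $(\mathcal{P}^n)$ if: (i) $X^n\to X$ uniformly; (ii) the Riemann sums $\int_0^tX^n_u\otimes\mathrm{d}X_u:=\sum_{k=0}^{N_n-1}X_{t^n_k}\otimes X_{t^n_k\wedge t,t^n_{k+1}\wedge t}$ converge uniformly in $t\in[0,T]$ as $n\to\infty$; (iii) there is a control function $w$ such that $$\sup_{(s,t)\in\Delta_T}\frac{|X_{s,t}|^p}{w(s,t)}+\sup_{n\in\mathbb{N}}\sup_{0\le k<\ell\le N_n}\frac{|\int_{t^n_k}^{t^n_\ell}X^n_u\otimes\mathrm{d}X_u-X_{t^n_k}\otimes X_{t^n_k,t^n_\ell}|^{p/2}}{w(t^n_k,t^n_\ell)}\le1,$$ where integrals over $[s,t]$ are differences of those over $[0,t]$ and $[0,s]$. *)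

theory Defs
  imports "HOL-Probability.Probability"
begin

text \<open>
  Paths, filtrations and processes are indexed by all of \<^typ>\<open>real\<close>, but only their values at
  times in \<open>[0,T]\<close> are ever constrained or used.
\<close>

section \<open>Brownian motion on a filtered probability space\<close>

locale usual_filtered_prob_space = prob_space M + complete_measure M
  for M :: "'a measure" +
  fixes T :: real and F :: "real \<Rightarrow> 'a measure"
  assumes subalgebra_F: "\<And>t. t \<in> {0..T} \<Longrightarrow> subalgebra M (F t)"
    and sets_F_mono: "\<And>s t. 0 \<le> s \<Longrightarrow> s \<le> t \<Longrightarrow> t \<le> T \<Longrightarrow> sets (F s) \<subseteq> sets (F t)"
    and right_continuous_F: "\<And>t. t \<in> {0..<T} \<Longrightarrow> sets (F t) = (\<Inter>u\<in>{t<..T}. sets (F u))"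
    and null_sets_F: "null_sets M \<subseteq> sets (F 0)"

locale brownian_motion = usual_filtered_prob_space M T F
  for M :: "'a measure" and T :: real and F :: "real \<Rightarrow> 'a measure" +
  fixes W :: "real \<Rightarrow> 'a \<Rightarrow> real ^ 'd"
  assumes adapted: "\<And>t. t \<in> {0..T} \<Longrightarrow> W t \<in> borel_measurable (F t)"
    and start_zero: "AE \<omega> in M. W 0 \<omega> = 0"
    and continuous_paths: "AE \<omega> in M. continuous_on {0..T} (\<lambda>t. W t \<omega>)"
    and increment_indep:
      "\<And>s t. 0 \<le> s \<Longrightarrow> s < t \<Longrightarrow> t \<le> T \<Longrightarrow>
         indep_set (sets (F s)) {(\<lambda>\<omega>. W t \<omega> - W s \<omega>) -` A \<inter> space M | A. A \<in> sets borel}"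
    \<comment> \<open>The next two assumptions say that \<open>W t - W s\<close> has law \<open>N(0, (t - s) I)\<close>; note that
      \<^const>\<open>normal_density\<close> takes the standard deviation.\<close>
    and increment_components_indep:
      "\<And>s t. 0 \<le> s \<Longrightarrow> s < t \<Longrightarrow> t \<le> T \<Longrightarrow>
         indep_vars (\<lambda>_. borel) (\<lambda>i \<omega>. (W t \<omega> - W s \<omega>) $ i) UNIV"
    and increment_components_normal:
      "\<And>s t i. 0 \<le> s \<Longrightarrow> s < t \<Longrightarrow> t \<le> T \<Longrightarrow>
         distributed M lborel (\<lambda>\<omega>. (W t \<omega> - W s \<omega>) $ i) (normal_density 0 (sqrt (t - s)))"

section \<open>Partitions, controls and paths\<close>

text \<open>A partition is given by its number \<open>N\<close> of subintervals and its points \<open>u 0, \<dots>, u N\<close>.\<close>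

definition is_partition :: "real \<Rightarrow> nat \<Rightarrow> (nat \<Rightarrow> real) \<Rightarrow> bool" where
  "is_partition T N u \<longleftrightarrow> u 0 = 0 \<and> u N = T \<and> (\<forall>i<N. u i < u (Suc i))"

definition mesh :: "nat \<Rightarrow> (nat \<Rightarrow> real) \<Rightarrow> real" where
  "mesh N u = Max ((\<lambda>i. \<bar>u (Suc i) - u i\<bar>) ` {..<N})"

definition time_simplex :: "real \<Rightarrow> (real \<times> real) set" where
  "time_simplex T = {(s, t). 0 \<le> s \<and> s \<le> t \<and> t \<le> T}"

definition control :: "real \<Rightarrow> (real \<Rightarrow> real \<Rightarrow> real) \<Rightarrow> bool" where
  "control T w \<longleftrightarrow>
     (\<forall>(s, t)\<in>time_simplex T. 0 \<le> w s t) \<and>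
     (\<forall>s u t. 0 \<le> s \<and> s \<le> u \<and> u \<le> t \<and> t \<le> T \<longrightarrow> w s u + w u t \<le> w s t)"

definition cadlag :: "real \<Rightarrow> (real \<Rightarrow> 'b::topological_space) \<Rightarrow> bool" where
  "cadlag T X \<longleftrightarrow>
     (\<forall>t\<in>{0..<T}. (X \<longlongrightarrow> X t) (at_right t)) \<and>
     (\<forall>t\<in>{0<..T}. \<exists>l. (X \<longlongrightarrow> l) (at_left t))"

definition tensor :: "real ^ 'd \<Rightarrow> real ^ 'd \<Rightarrow> real ^ 'd ^ 'd" (infixl "\<otimes>\<^sub>v" 70) where
  "x \<otimes>\<^sub>v y = (\<chi> i j. x $ i * y $ j)"

section \<open>Property (RIE)\<close>

definition discretized ::
    "real \<Rightarrow> nat \<Rightarrow> (nat \<Rightarrow> real) \<Rightarrow> (real \<Rightarrow> real ^ 'd) \<Rightarrow> real \<Rightarrow> real ^ 'd" where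
  "discretized T N u X t =
     indicator {T} t *\<^sub>R X T + (\<Sum>k<N. indicator {u k..<u (Suc k)} t *\<^sub>R X (u k))"

definition riemann_sum ::
    "nat \<Rightarrow> (nat \<Rightarrow> real) \<Rightarrow> (real \<Rightarrow> real ^ 'd) \<Rightarrow> real \<Rightarrow> real ^ 'd ^ 'd" where
  "riemann_sum N u X t =
     (\<Sum>k<N. X (u k) \<otimes>\<^sub>v (X (min (u (Suc k)) t) - X (min (u k) t)))"

text \<open>
  The quotients in the control bound are taken in \<^typ>\<open>ennreal\<close>, where \<open>0 / 0 = 0\<close> but
  \<open>a / 0 = \<infinity>\<close> for \<open>a > 0\<close>; division in \<^typ>\<open>real\<close> would make the bound vacuous wherever \<open>w\<close>
  vanishes.  The norm on \<^typ>\<open>real ^ 'd ^ 'd\<close> is the Frobenius norm.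
\<close>

definition property_RIE ::
    "real \<Rightarrow> real \<Rightarrow> (nat \<Rightarrow> nat) \<Rightarrow> (nat \<Rightarrow> nat \<Rightarrow> real) \<Rightarrow> (real \<Rightarrow> real ^ 'd) \<Rightarrow> bool" where
  "property_RIE T p N \<tau> X \<longleftrightarrow>
     2 < p \<and> p < 3 \<and>
     (\<forall>n. is_partition T (N n) (\<tau> n)) \<and>
     (\<lambda>n. mesh (N n) (\<tau> n)) \<longlonglongrightarrow> 0 \<and>
     cadlag T X \<and>
     uniform_limit {0..T} (\<lambda>n. discretized T (N n) (\<tau> n) X) X sequentially \<and>
     uniformly_convergent_on {0..T} (\<lambda>n. riemann_sum (N n) (\<tau> n) X) \<and>
     (\<exists>w. control T w \<and>
        (SUP (s, t)\<in>time_simplex T. ennreal (norm (X t - X s) powr p) / ennreal (w s t)) +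
        (SUP n. SUP (k, l)\<in>{(k, l). k < l \<and> l \<le> N n}.
           ennreal (norm (riemann_sum (N n) (\<tau> n) X (\<tau> n l) - riemann_sum (N n) (\<tau> n) X (\<tau> n k)
                          - X (\<tau> n k) \<otimes>\<^sub>v (X (\<tau> n l) - X (\<tau> n k))) powr (p / 2))
           / ennreal (w (\<tau> n k) (\<tau> n l)))
        \<le> 1)"

end

theory Submission
  imports Defs
begin

text \<open>
  An equidistant partition of \<open>[0,T]\<close> is determined by its number \<open>N\<close> of intervals, and the assumed
  limit forces \<open>\<pi>\<^sub>n \<rightarrow> 0\<close>, that is, \<open>N\<^sub>n \<rightarrow> \<infinity>\<close>.  So it suffices to show that almost every path has all
  the required estimates for the grids \<open>k T / N\<close> with constants that do not depend on \<open>N\<close>; a union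
  bound over all \<open>N\<close> and all pairs of grid points costs a polynomial factor only, which is beaten
  by moments of high order.

  Write \<open>R\<^sub>N\<close> for the Riemann sum along the grid with \<open>N\<close> intervals and \<open>\<epsilon> = 2/p - 1/2 > 0\<close>.
  Along the common refinement of the grids with \<open>N\<close> and \<open>K \<ge> N\<close> intervals the increment of
  \<open>R\<^sub>K - R\<^sub>N\<close> over \<open>[s,t]\<close> is a discrete stochastic integral
  (\<open>riemann_diff_common_refinement\<close>) whose integrand has variance at most \<open>T/N\<close>.  A
  Burkholder-type bound for Gaussian increments (\<open>moment_add_indep_normal\<close>, iterated in
  \<open>transform_moment\<close>) gives the moment of order \<open>2q\<close> the size \<open>((t - s)/N)\<^sup>q\<close>.  Divided by
  \<open>(N\<^sup>-\<^sup>\<epsilon> (t - s)\<^sup>1\<^sup>/\<^sup>2)\<^sup>2\<^sup>q\<close> this is \<open>N\<close> to the power \<open>-q (2 - 4/p)\<close>, so for large \<open>q\<close> it can be summed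
  over all \<open>N\<close> and all grid points \<open>s < t\<close>.  Hence almost surely
  \<open>|(R\<^sub>K - R\<^sub>N)\<^sub>s\<^sub>,\<^sub>t| \<le> C N\<^sup>-\<^sup>\<epsilon> (t - s)\<^sup>1\<^sup>/\<^sup>2\<close> simultaneously for all \<open>N\<close>, with \<open>K = 2N\<close> as well as
  \<open>K = 2\<^sup>N\<close> (\<open>AE_riemann_diff_bound\<close>).  The increments of the path on dyadic intervals are
  treated in the same way (\<open>AE_dyadic_increment_bound\<close>).

  The rest is deterministic and is carried out in the locale \<open>area_regular_path\<close>.
  The estimate with \<open>K = 2N\<close> makes the dyadic Riemann sums converge uniformly to some \<open>J\<close>.
  On a dyadic interval of length \<open>T/2\<^sup>n\<close> the area \<open>A\<^sub>s\<^sub>,\<^sub>t = J\<^sub>t - J\<^sub>s - X\<^sub>s \<otimes> (X\<^sub>t - X\<^sub>s)\<close> telescopes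
  into the terms \<open>m \<ge> n\<close>, which sum up to a multiple of \<open>(2\<^sup>-\<^sup>n)\<^sup>2\<^sup>/\<^sup>p\<close>.  Chaining extends this to all
  intervals: by Chen's relation \<open>max |X\<^sub>t - X\<^sub>s| |A\<^sub>s\<^sub>,\<^sub>t|\<^sup>1\<^sup>/\<^sup>2\<close> is subadditive, so
  \<open>hoelder_if_dyadic_hoelder\<close> applies to it exactly as to \<open>|X\<^sub>t - X\<^sub>s|\<close>.  Finally the estimate
  with \<open>K = 2\<^sup>N\<close> compares \<open>R\<^sub>N\<close> with \<open>J\<close> on arbitrary grids, and since two different grid points
  have distance at least \<open>T/N\<close>, the error \<open>N\<^sup>-\<^sup>\<epsilon> (t - s)\<^sup>1\<^sup>/\<^sup>2\<close> is at most a multiple of \<open>(t - s)\<^sup>2\<^sup>/\<^sup>p\<close>.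
  A multiple of \<open>t - s\<close> then serves as control function.
\<close>

section \<open>Tensor products and geometrically convergent sequences\<close>

lemma norm_tensor: "norm (x \<otimes>\<^sub>v y) = norm x * norm y"
proof -
  have "norm ((x \<otimes>\<^sub>v y) $ i) = \<bar>x $ i\<bar> * norm y" for i
  proof -
    have "(x \<otimes>\<^sub>v y) $ i = x $ i *\<^sub>R y" by (simp add: tensor_def vec_eq_iff)
    then show ?thesis by simp
  qed
  then show ?thesis
    by (simp add: norm_vec_def L2_set_left_distrib)
qed

lemma bounded_bilinear_tensor: "bounded_bilinear ((\<otimes>\<^sub>v) :: real ^ 'd \<Rightarrow> real ^ 'd \<Rightarrow> _)"
proof
  show "\<exists>K. \<forall>a b :: real ^ 'd. norm (a \<otimes>\<^sub>v b) \<le> norm a * norm b * K"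
    by (rule exI[of _ 1]) (simp add: norm_tensor)
qed (simp_all add: tensor_def vec_eq_iff algebra_simps)

interpretation tensor: bounded_bilinear "(\<otimes>\<^sub>v) :: real ^ 'd \<Rightarrow> real ^ 'd \<Rightarrow> _"
  by (rule bounded_bilinear_tensor)

lemma geometric_increments:
  fixes f :: "nat \<Rightarrow> 'b::banach"
  assumes inc: "\<And>m. norm (f (Suc m) - f m) \<le> B * \<rho> ^ m" and \<rho>: "0 \<le> \<rho>" "\<rho> < 1"
  shows "convergent f" and "f \<longlonglongrightarrow> L \<Longrightarrow> norm (L - f m) \<le> B * \<rho> ^ m / (1 - \<rho>)"
proof -
  have geo: "summable (\<lambda>i. B * \<rho> ^ m * \<rho> ^ i)" for m
    using \<rho> by (intro summable_mult summable_geometric) auto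
  have inc': "norm (f (Suc (m + i)) - f (m + i)) \<le> B * \<rho> ^ m * \<rho> ^ i" for m i
    using inc[of "m + i"] by (simp add: power_add mult_ac)
  have sm: "summable (\<lambda>i. norm (f (Suc (m + i)) - f (m + i)))" for m
    by (rule summable_comparison_test'[OF geo[of m], of 0]) (use inc' in auto)
  have "summable (\<lambda>i. f (Suc i) - f i)" using summable_norm_cancel[OF sm[of 0]] by simp
  then have "convergent (\<lambda>n. f n - f 0)"
    unfolding summable_iff_convergent sum_lessThan_telescope .
  from convergent_add[OF this convergent_const[of "f 0"]] show "convergent f" by simp
  assume L: "f \<longlonglongrightarrow> L"
  have "(\<lambda>i. f (Suc (m + i)) - f (m + i)) sums (L - f m)"
    using telescope_sums[of "\<lambda>i. f (m + i)" L] LIMSEQ_ignore_initial_segment[OF L, of m]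
    by (simp add: add.commute)
  then have "norm (L - f m) \<le> (\<Sum>i. norm (f (Suc (m + i)) - f (m + i)))"
    using summable_norm[OF sm, of m] by (simp add: sums_iff)
  also have "\<dots> \<le> (\<Sum>i. B * \<rho> ^ m * \<rho> ^ i)"
    by (intro suminf_le inc' sm geo)
  also have "\<dots> = B * \<rho> ^ m / (1 - \<rho>)"
    using \<rho> by (subst suminf_mult) (auto simp: suminf_geometric)
  finally show "norm (L - f m) \<le> B * \<rho> ^ m / (1 - \<rho>)" .
qed

section \<open>Equidistant grids\<close>

definition grid :: "real \<Rightarrow> nat \<Rightarrow> nat \<Rightarrow> real" where
  "grid T N k = real k * T / real N"

lemma grid_0 [simp]: "grid T N 0 = 0" by (simp add: grid_def)

lemma grid_last: "0 < N \<Longrightarrow> grid T N N = T" by (simp add: grid_def)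

lemma grid_diff: "k \<le> l \<Longrightarrow> grid T N l - grid T N k = real (l - k) * T / real N"
  by (simp add: grid_def of_nat_diff diff_divide_distrib left_diff_distrib)

lemma grid_mono: "0 \<le> T \<Longrightarrow> k \<le> l \<Longrightarrow> grid T N k \<le> grid T N l"
  by (simp add: grid_def divide_right_mono mult_right_mono)

lemma grid_in: "0 \<le> T \<Longrightarrow> k \<le> N \<Longrightarrow> grid T N k \<in> {0..T}"
  using grid_mono[of T 0 k N] grid_mono[of T k N N]
  by (cases "N = 0") (simp_all add: grid_last)

lemma grid_refine: "0 < K \<Longrightarrow> grid T (N * K) (k * K) = grid T N k"
  by (simp add: grid_def)

lemma grid_cell:
  assumes "0 < T" "0 < N" "t \<in> {0..T}"
  obtains k where "k < N" "grid T N k \<le> t" "t \<le> grid T N (Suc k)"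
proof (cases "t = T")
  case True
  have "grid T N (N - 1) \<le> grid T N N" using assms by (intro grid_mono) auto
  then show ?thesis using that[of "N - 1"] assms True by (simp add: grid_last)
next
  case False
  define k where "k = nat \<lfloor>t * N / T\<rfloor>"
  have "0 \<le> t * N / T" using assms by simp
  then have "real k \<le> t * N / T" "t * N / T < real (Suc k)"
    unfolding k_def by linarith+
  moreover from this have "k < N"
  proof -
    have "t * N / T < N" using False assms by (simp add: field_simps)
    with \<open>real k \<le> t * N / T\<close> show ?thesis by linarith
  qed
  ultimately show ?thesis
    using that[of k] assms by (simp add: grid_def field_simps)
qed

section \<open>Chaining along dyadic points\<close>

text \<open>
  Trim the interval between two points of level \<open>m + 1\<close> to the largest interval inside it whose end
  points are of level \<open>m\<close>.  This cuts off at most one interval of level \<open>m + 1\<close> at either end and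
  does not enlarge the distance, so the bound picks up at most \<open>2 C \<rho>\<^sup>m\<^sup>+\<^sup>1\<close> per level,
  beginning at the level \<open>n\<close> that corresponds to the distance of the two points.
\<close>

lemma dyadic_chaining:
  fixes d :: "real \<Rightarrow> real \<Rightarrow> real"
  assumes T: "0 < T" and \<rho>: "0 \<le> \<rho>" and C: "0 \<le> C"
    and tri: "\<And>s u t. 0 \<le> s \<Longrightarrow> s \<le> u \<Longrightarrow> u \<le> t \<Longrightarrow> t \<le> T \<Longrightarrow> d s t \<le> d s u + d u t"
    and refl: "\<And>t. 0 \<le> t \<Longrightarrow> t \<le> T \<Longrightarrow> d t t = 0"
    and unit: "\<And>m k. k < 2 ^ m \<Longrightarrow> d (grid T (2 ^ m) k) (grid T (2 ^ m) (Suc k)) \<le> C * \<rho> ^ m"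
  shows "j \<le> k \<Longrightarrow> k \<le> 2 ^ m \<Longrightarrow> n \<le> m \<Longrightarrow> (k - j) * 2 ^ n \<le> 2 ^ m \<Longrightarrow>
    d (grid T (2 ^ m) j) (grid T (2 ^ m) k) \<le> 2 * C * (\<Sum>i=n..m. \<rho> ^ i)"
proof (induction m arbitrary: j k)
  case (0 j k)
  then have "k = j \<or> k = Suc j" by auto
  moreover have "d (grid T (2 ^ 0) j) (grid T (2 ^ 0) j) = 0"
    using grid_in[of T j "2 ^ 0"] T 0 by (intro refl) auto
  ultimately show ?case using 0 unit[of j 0] C by auto
next
  case (Suc m j k)
  let ?g = "grid T (2 ^ Suc m)"
  have gin: "?g i \<in> {0..T}" if "i \<le> 2 ^ Suc m" for i using grid_in[of T i "2 ^ Suc m"] T that by simp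
  have short: "d (?g i) (?g i') \<le> C * \<rho> ^ Suc m" if "i \<le> i'" "i' \<le> Suc i" "i' \<le> 2 ^ Suc m" for i i'
  proof -
    have "i' = i \<or> i' = Suc i" using that by auto
    then show ?thesis using refl[of "?g i"] gin[of i] unit[of i "Suc m"] that C \<rho> by auto
  qed
  have S0: "0 \<le> (\<Sum>i=n..m. \<rho> ^ i)" using \<rho> by (intro sum_nonneg) auto
  show ?case
  proof (cases "n = Suc m")
    case True
    then have "k \<le> Suc j" using Suc.prems by (cases "k - j") auto
    then have "d (?g j) (?g k) \<le> C * \<rho> ^ Suc m" using Suc.prems by (intro short) auto
    also have "\<dots> \<le> 2 * C * \<rho> ^ Suc m" using C \<rho> by (intro mult_right_mono) auto
    finally show ?thesis using True by simp
  next
    case False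
    then have n: "n \<le> m" using Suc.prems by simp
    define j' k' where "j' = Suc j div 2" and "k' = k div 2"
    have jk: "j \<le> 2 * j'" "2 * j' \<le> Suc j" "2 * k' \<le> k" "k \<le> Suc (2 * k')"
      by (auto simp: j'_def k'_def)
    have sumS: "(\<Sum>i=n..Suc m. \<rho> ^ i) = (\<Sum>i=n..m. \<rho> ^ i) + \<rho> ^ Suc m" using n by simp
    show ?thesis
    proof (cases "j' \<le> k'")
      case True
      have kk: "2 * k' \<le> 2 ^ Suc m" "k' \<le> 2 ^ m" using jk(3) Suc.prems(2) by auto
      have "(k' - j') * 2 \<le> k - j" using jk True by linarith
      then have "(k' - j') * 2 * 2 ^ n \<le> (k - j) * 2 ^ n" by (rule mult_right_mono) simp
      also have "\<dots> \<le> 2 ^ m * 2" using Suc.prems by simp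
      finally have "(k' - j') * 2 ^ n \<le> 2 ^ m" by simp
      then have IH: "d (grid T (2 ^ m) j') (grid T (2 ^ m) k') \<le> 2 * C * (\<Sum>i=n..m. \<rho> ^ i)"
        using True kk n by (intro Suc.IH) auto
      have half: "grid T (2 ^ m) i = ?g (2 * i)" for i
        using grid_refine[of 2 T "2 ^ m" i] by (simp add: mult.commute)
      have mono: "?g a \<le> ?g b" if "a \<le> b" for a b using grid_mono that T by simp
      have "d (?g j) (?g k) \<le> d (?g j) (?g (2 * j')) + d (?g (2 * j')) (?g k)"
        using gin[of j] gin[of k] jk True Suc.prems by (intro tri mono) auto
      also have "d (?g (2 * j')) (?g k) \<le> d (?g (2 * j')) (?g (2 * k')) + d (?g (2 * k')) (?g k)"
        using gin[of "2 * j'"] gin[of k] jk True Suc.prems by (intro tri mono) auto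
      finally have "d (?g j) (?g k) \<le> d (?g j) (?g (2 * j')) + d (?g (2 * j')) (?g (2 * k')) + d (?g (2 * k')) (?g k)"
        by simp
      moreover have "d (?g j) (?g (2 * j')) \<le> C * \<rho> ^ Suc m" using jk True kk by (intro short) auto
      moreover have "d (?g (2 * k')) (?g k) \<le> C * \<rho> ^ Suc m" using jk Suc.prems by (intro short) auto
      ultimately show ?thesis using IH unfolding half sumS by (simp add: algebra_simps)
    next
      case False
      then have "k = j" using jk Suc.prems(1) by auto
      then have "d (?g j) (?g k) = 0" using gin[of j] Suc.prems by (auto intro!: refl)
      moreover have "0 \<le> 2 * C * (\<Sum>i=n..Suc m. \<rho> ^ i)" unfolding sumS using S0 C \<rho> by auto
      ultimately show ?thesis by simp
    qed
  qed
qed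

text \<open>
  The Kolmogorov-Chentsov chaining step, for a subadditive two-parameter function in place of the
  distance of two values of a path.  This generality makes it applicable to a path and to its area at once.
\<close>

lemma hoelder_if_dyadic_hoelder:
  fixes d :: "real \<Rightarrow> real \<Rightarrow> real"
  assumes T: "0 < T" and \<alpha>: "0 < \<alpha>" and C: "0 \<le> C"
    and tri: "\<And>s u t. 0 \<le> s \<Longrightarrow> s \<le> u \<Longrightarrow> u \<le> t \<Longrightarrow> t \<le> T \<Longrightarrow> d s t \<le> d s u + d u t"
    and refl: "\<And>t. 0 \<le> t \<Longrightarrow> t \<le> T \<Longrightarrow> d t t = 0"
    and unit: "\<And>m k. k < 2 ^ m \<Longrightarrow>
      d (grid T (2 ^ m) k) (grid T (2 ^ m) (Suc k)) \<le> C * (2 powr - \<alpha>) ^ m"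
    and cont: "continuous_on ({0..T} \<times> {0..T}) (\<lambda>(s, t). d s t)"
  shows "\<exists>K\<ge>0. \<forall>s t. 0 \<le> s \<longrightarrow> s \<le> t \<longrightarrow> t \<le> T \<longrightarrow> d s t \<le> K * (t - s) powr \<alpha>"
proof -
  define \<rho> where "\<rho> = 2 powr - \<alpha>"
  have \<rho>: "0 < \<rho>" "\<rho> < 1" using \<alpha> by (auto simp: \<rho>_def powr_less_one)
  define K where "K = 2 * C / (1 - \<rho>) * (2 / T) powr \<alpha>"
  have K: "0 \<le> K" using C \<rho> by (simp add: K_def)
  have dy: "d (grid T (2 ^ m) j) (grid T (2 ^ m) k) \<le> K * (grid T (2 ^ m) k - grid T (2 ^ m) j) powr \<alpha>"
    if jk: "j \<le> k" "k \<le> 2 ^ m" for j k m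
  proof (cases "j = k")
    case True
    then show ?thesis using refl[of "grid T (2 ^ m) k"] grid_in[of T k "2 ^ m"] T that by simp
  next
    case False
    \<comment> \<open>the dyadic scale of the distance: \<open>2\<^sup>-\<^sup>n\<^sup>-\<^sup>1 \<le> (k - j) / 2\<^sup>m \<le> 2\<^sup>-\<^sup>n\<close>\<close>
    define n where "n = Greatest (\<lambda>n. n \<le> m \<and> (k - j) * 2 ^ n \<le> 2 ^ m)"
    have "n \<le> m \<and> (k - j) * 2 ^ n \<le> 2 ^ m"
      unfolding n_def by (rule GreatestI_nat[of _ 0 m]) (use jk in auto)
    then have n: "n \<le> m" "(k - j) * 2 ^ n \<le> 2 ^ m" by auto
    have n2: "2 ^ m \<le> (k - j) * 2 ^ Suc n"
    proof (cases "n = m")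
      case True
      then show ?thesis using False that by (cases "k - j") auto
    next
      case False
      show ?thesis
      proof (rule ccontr)
        assume "\<not> ?thesis"
        then have "Suc n \<le> m \<and> (k - j) * 2 ^ Suc n \<le> 2 ^ m" using n False by auto
        then have "Suc n \<le> n" unfolding n_def by (rule Greatest_le_nat[where b = m]) auto
        then show False by simp
      qed
    qed
    have "\<rho> ^ n = 2 powr (- \<alpha> * real n)" by (simp add: \<rho>_def powr_realpow[symmetric] powr_powr)
    also have "\<dots> = (2 powr (- real n)) powr \<alpha>" by (simp add: powr_powr mult.commute)
    also have "\<dots> \<le> (2 / T * (grid T (2 ^ m) k - grid T (2 ^ m) j)) powr \<alpha>"
    proof (rule powr_mono2)
      have "(2::real) ^ m \<le> real (k - j) * 2 ^ Suc n"
        using of_nat_mono[OF n2, where 'a = real] by simp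
      then show "2 powr (- real n) \<le> 2 / T * (grid T (2 ^ m) k - grid T (2 ^ m) j)"
        unfolding grid_diff[OF jk(1)] using T by (simp add: powr_minus powr_realpow field_simps)
    qed (use \<alpha> in auto)
    also have "\<dots> = (2 / T) powr \<alpha> * (grid T (2 ^ m) k - grid T (2 ^ m) j) powr \<alpha>"
      using T jk by (intro powr_mult)
    finally have \<rho>n: "\<rho> ^ n \<le> (2 / T) powr \<alpha> * (grid T (2 ^ m) k - grid T (2 ^ m) j) powr \<alpha>" .
    have "(\<Sum>i=n..m. \<rho> ^ i) = (\<rho> ^ n - \<rho> ^ Suc m) / (1 - \<rho>)"
      using sum_gp[of \<rho> n m] \<rho> n by auto
    also have "\<dots> \<le> (2 / T) powr \<alpha> * (grid T (2 ^ m) k - grid T (2 ^ m) j) powr \<alpha> / (1 - \<rho>)"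
      using \<rho> zero_le_power[of \<rho> "Suc m"] by (intro divide_right_mono) (auto intro!: order.trans[OF _ \<rho>n])
    finally have sum_le: "(\<Sum>i=n..m. \<rho> ^ i) \<le> (2 / T) powr \<alpha> * (grid T (2 ^ m) k - grid T (2 ^ m) j) powr \<alpha> / (1 - \<rho>)" .
    have "d (grid T (2 ^ m) j) (grid T (2 ^ m) k) \<le> 2 * C * (\<Sum>i=n..m. \<rho> ^ i)"
      by (rule dyadic_chaining[OF T less_imp_le[OF \<rho>(1)] C tri refl unit[folded \<rho>_def] jk n])
    also have "\<dots> \<le> 2 * C * ((2 / T) powr \<alpha> * (grid T (2 ^ m) k - grid T (2 ^ m) j) powr \<alpha> / (1 - \<rho>))"
      using C by (intro mult_left_mono sum_le) simp
    also have "\<dots> = K * (grid T (2 ^ m) k - grid T (2 ^ m) j) powr \<alpha>" by (simp add: K_def)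
    finally show ?thesis .
  qed
  \<comment> \<open>the largest dyadic point of level \<open>m\<close> up to \<open>t\<close>\<close>
  define a where "a t m = grid T (2 ^ m) (nat \<lfloor>t * 2 ^ m / T\<rfloor>)" for t and m :: nat
  have a_bound: "t - T / 2 ^ m \<le> a t m" "a t m \<le> t" if "0 \<le> t" for t m
  proof -
    define k where "k = nat \<lfloor>t * 2 ^ m / T\<rfloor>"
    have "0 \<le> t * 2 ^ m / T" using that T by simp
    then have "real k \<le> t * 2 ^ m / T" "t * 2 ^ m / T \<le> real k + 1"
      unfolding k_def by linarith+
    then have k: "real k * T \<le> t * 2 ^ m" "t * 2 ^ m \<le> (real k + 1) * T"
      using T by (simp_all add: pos_le_divide_eq pos_divide_le_eq)
    from k(2) have "t \<le> (real k + 1) * T / 2 ^ m" by (simp add: pos_le_divide_eq)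
    also have "\<dots> = a t m + T / 2 ^ m" by (simp add: a_def grid_def k_def add_divide_distrib distrib_right)
    finally show "t - T / 2 ^ m \<le> a t m" by simp
    from k(1) show "a t m \<le> t" by (simp add: a_def grid_def k_def pos_divide_le_eq)
  qed
  have a_lim: "a t \<longlonglongrightarrow> t" if "0 \<le> t" for t
  proof (rule tendsto_sandwich[where h = "\<lambda>_. t"])
    have "(\<lambda>m. t - T * (1 / 2) ^ m) \<longlonglongrightarrow> t - T * 0"
      by (intro tendsto_intros LIMSEQ_power_zero) simp
    then show "(\<lambda>m. t - T / 2 ^ m) \<longlonglongrightarrow> t"
      by (simp add: power_one_over)
  qed (use a_bound[OF that] in \<open>auto intro: always_eventually\<close>)
  have a_idx: "nat \<lfloor>t * 2 ^ m / T\<rfloor> \<le> 2 ^ m" if "t \<le> T" "0 \<le> t" for t m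
  proof -
    have "t * 2 ^ m / T \<le> 2 ^ m" using that T by (simp add: field_simps)
    then show ?thesis using floor_mono[of "t * 2 ^ m / T" "2 ^ m"] by (simp add: nat_le_iff)
  qed
  have "d s t \<le> K * (t - s) powr \<alpha>" if st: "0 \<le> s" "s \<le> t" "t \<le> T" for s t
  proof (rule LIMSEQ_le)
    have ain: "a r m \<in> {0..T}" if "0 \<le> r" "r \<le> T" for r m
      unfolding a_def using grid_in[OF _ a_idx[OF that(2,1), of m]] T by simp
    have "(\<lambda>m. case (a s m, a t m) of (s, t) \<Rightarrow> d s t) \<longlonglongrightarrow> (case (s, t) of (s, t) \<Rightarrow> d s t)"
      using st a_lim[of s] a_lim[of t] ain
      by (intro continuous_on_tendsto_compose[OF cont] tendsto_Pair always_eventually) auto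
    then show "(\<lambda>m. d (a s m) (a t m)) \<longlonglongrightarrow> d s t" by simp
    have idx: "nat \<lfloor>s * 2 ^ m / T\<rfloor> \<le> nat \<lfloor>t * 2 ^ m / T\<rfloor>" for m
      using st T by (intro nat_mono floor_mono divide_right_mono mult_right_mono) auto
    show "(\<lambda>m. K * (a t m - a s m) powr \<alpha>) \<longlonglongrightarrow> K * (t - s) powr \<alpha>"
    proof (intro tendsto_mult tendsto_const tendsto_powr' tendsto_diff a_lim)
      have "0 \<le> a t m - a s m" for m unfolding a_def using grid_mono[OF _ idx] T by simp
      then show "t - s \<noteq> 0 \<or> 0 < \<alpha> \<and> (\<forall>\<^sub>F m in sequentially. 0 \<le> a t m - a s m)"
        using \<alpha> by simp
    qed (use st in auto)
    have "d (a s m) (a t m) \<le> K * (a t m - a s m) powr \<alpha>" for m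
      unfolding a_def using st a_idx[of t m] by (intro dy idx) auto
    then show "\<exists>n0. \<forall>m\<ge>n0. d (a s m) (a t m) \<le> K * (a t m - a s m) powr \<alpha>" by blast
  qed
  with K show ?thesis by blast
qed

section \<open>Riemann sums along equidistant grids\<close>

lemma riemann_sum_increment:
  assumes u: "incseq u" and k: "k < N" "u k \<le> s" "s \<le> t" "t \<le> u (Suc k)"
  shows "riemann_sum N u X t - riemann_sum N u X s = X (u k) \<otimes>\<^sub>v (X t - X s)"
proof -
  have "riemann_sum N u X t - riemann_sum N u X s
      = (\<Sum>i<N. X (u i) \<otimes>\<^sub>v ((X (min (u (Suc i)) t) - X (min (u i) t)) - (X (min (u (Suc i)) s) - X (min (u i) s))))"
    by (simp add: riemann_sum_def sum_subtractf tensor.diff_right)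
  also have "\<dots> = (\<Sum>i<N. if i = k then X (u k) \<otimes>\<^sub>v (X t - X s) else 0)"
  proof (rule sum.cong[OF HOL.refl])
    fix i assume "i \<in> {..<N}"
    consider "i < k" | "i = k" | "k < i" by linarith
    then show "X (u i) \<otimes>\<^sub>v ((X (min (u (Suc i)) t) - X (min (u i) t)) - (X (min (u (Suc i)) s) - X (min (u i) s)))
        = (if i = k then X (u k) \<otimes>\<^sub>v (X t - X s) else 0)"
    proof cases
      case 1
      then have "u (Suc i) \<le> u k" "u i \<le> u k" using u by (auto simp: incseq_def)
      with k 1 show ?thesis by (simp add: min_absorb1 tensor.zero_right)
    next
      case 2
      with k show ?thesis by (simp add: min_absorb1 min_absorb2)
    next
      case 3
      then have "u (Suc k) \<le> u (Suc i)" "u (Suc k) \<le> u i" using u by (auto simp: incseq_def)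
      with k 3 show ?thesis by (simp add: min_absorb2 tensor.zero_right)
    qed
  qed
  also have "\<dots> = X (u k) \<otimes>\<^sub>v (X t - X s)" using k by (subst sum.delta) auto
  finally show ?thesis .
qed

lemma riemann_sum_grid_increment:
  assumes "0 \<le> T" "k < N" "grid T N k \<le> s" "s \<le> t" "t \<le> grid T N (Suc k)"
  shows "riemann_sum N (grid T N) X t - riemann_sum N (grid T N) X s = X (grid T N k) \<otimes>\<^sub>v (X t - X s)"
  using assms by (intro riemann_sum_increment) (auto simp: incseq_def grid_mono)

lemma riemann_sum_0: "(\<And>i. 0 \<le> u i) \<Longrightarrow> riemann_sum N u X 0 = 0"
  by (simp add: riemann_sum_def min_absorb2 tensor.zero_right)

lemma riemann_sum_grid_refined:
  assumes T: "0 \<le> T" and N: "0 < N" and K: "0 < K" and ab: "a \<le> b" "b \<le> N * K"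
  shows "riemann_sum N (grid T N) X (grid T (N * K) b) - riemann_sum N (grid T N) X (grid T (N * K) a)
    = (\<Sum>i=a..<b. X (grid T N (i div K)) \<otimes>\<^sub>v (X (grid T (N * K) (Suc i)) - X (grid T (N * K) i)))"
proof -
  have "(\<Sum>i=a..<b. X (grid T N (i div K)) \<otimes>\<^sub>v (X (grid T (N * K) (Suc i)) - X (grid T (N * K) i)))
    = (\<Sum>i=a..<b. riemann_sum N (grid T N) X (grid T (N * K) (Suc i)) - riemann_sum N (grid T N) X (grid T (N * K) i))"
  proof (rule sum.cong[OF HOL.refl])
    fix i assume "i \<in> {a..<b}"
    then have "i < N * K" using ab by auto
    then have "i div K < N" by (simp add: less_mult_imp_div_less)
    moreover have "grid T N (i div K) \<le> grid T (N * K) i"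
      unfolding grid_refine[OF K, of T N, symmetric] using T by (intro grid_mono) auto
    moreover have "grid T (N * K) (Suc i) \<le> grid T N (Suc (i div K))"
      unfolding grid_refine[OF K, of T N, symmetric] using T K dividend_less_div_times[OF K, of i]
      by (intro grid_mono) auto
    ultimately show "X (grid T N (i div K)) \<otimes>\<^sub>v (X (grid T (N * K) (Suc i)) - X (grid T (N * K) i))
      = riemann_sum N (grid T N) X (grid T (N * K) (Suc i)) - riemann_sum N (grid T N) X (grid T (N * K) i)"
      using T by (intro riemann_sum_grid_increment[symmetric] grid_mono) auto
  qed
  also have "\<dots> = riemann_sum N (grid T N) X (grid T (N * K) b) - riemann_sum N (grid T N) X (grid T (N * K) a)"
    by (rule sum_Suc_diff'[OF ab(1), of "\<lambda>i. riemann_sum N (grid T N) X (grid T (N * K) i)"])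
  finally show ?thesis by (rule sym)
qed

definition riemann_diff :: "real \<Rightarrow> nat \<Rightarrow> nat \<Rightarrow> (real \<Rightarrow> real ^ 'd) \<Rightarrow> real \<Rightarrow> real ^ 'd ^ 'd" where
  "riemann_diff T M N X t = riemann_sum M (grid T M) X t - riemann_sum N (grid T N) X t"

lemma diff_diff_swap: "(a - b) - (c - d) = (a - c) - (b - d)" for a b c d :: "'b::ab_group_add"
  by simp

text \<open>
  On the common refinement, both Riemann sums integrate step functions against the same increments;
  \<open>i div N\<close> and \<open>i div M\<close> are the indices of the last points of the two coarse grids up to the \<open>i\<close>-th
  point of the refinement.
\<close>

lemma riemann_diff_common_refinement:
  assumes T: "0 \<le> T" and N: "0 < N" and M: "0 < M" and kl: "k \<le> l" "l \<le> N"
  shows "riemann_diff T M N X (grid T N l) - riemann_diff T M N X (grid T N k)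
    = (\<Sum>i=k * M..<l * M. (X (grid T M (i div N)) - X (grid T N (i div M)))
        \<otimes>\<^sub>v (X (grid T (N * M) (Suc i)) - X (grid T (N * M) i)))"
proof -
  let ?R = "\<lambda>N. riemann_sum N (grid T N) X" and ?g = "grid T (N * M)"
  have "k * M \<le> l * M" "l * M \<le> N * M" using kl by auto
  note riemann_sum_grid_refined[OF T N M this, of X]
    riemann_sum_grid_refined[OF T M N this[unfolded mult.commute[of N M]], of X]
  moreover have "?g (k * M) = grid T N k" "?g (l * M) = grid T N l" using M by (simp_all add: grid_refine)
  ultimately have "?R N (grid T N l) - ?R N (grid T N k)
      = (\<Sum>i=k * M..<l * M. X (grid T N (i div M)) \<otimes>\<^sub>v (X (?g (Suc i)) - X (?g i)))"
    "?R M (grid T N l) - ?R M (grid T N k)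
      = (\<Sum>i=k * M..<l * M. X (grid T M (i div N)) \<otimes>\<^sub>v (X (?g (Suc i)) - X (?g i)))"
    unfolding mult.commute[of M N] by simp_all
  then show ?thesis
    unfolding riemann_diff_def tensor.diff_left sum_subtractf by (subst diff_diff_swap) simp
qed

lemma continuous_on_riemann_sum:
  assumes X: "continuous_on {0..T} X" and u: "\<And>i. i \<le> N \<Longrightarrow> 0 \<le> u i"
  shows "continuous_on {0..T} (riemann_sum N u X)"
proof -
  have "continuous_on {0..T} (\<lambda>t. X (min (u i) t))" if "i \<le> N" for i
    by (rule continuous_on_compose2[OF X]) (use u[OF that] in \<open>auto intro!: continuous_intros\<close>)
  then have "continuous_on {0..T} (\<lambda>t. X (min (u (Suc i)) t) - X (min (u i) t))" if "i < N" for i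
    using that by (intro continuous_on_diff) auto
  then show ?thesis unfolding riemann_sum_def
    by (intro continuous_on_sum tensor.continuous_on continuous_on_const) auto
qed

lemma uniform_limit_if_bounded:
  assumes "\<And>n t. t \<in> S \<Longrightarrow> dist (f n t) (l t) \<le> b n" and "b \<longlonglongrightarrow> (0::real)"
  shows "uniform_limit S f l sequentially"
proof (rule uniform_limitI)
  fix e :: real assume "0 < e"
  then have "\<forall>\<^sub>F n in sequentially. b n < e" using assms(2) by (rule order_tendstoD(2)[rotated])
  then show "\<forall>\<^sub>F n in sequentially. \<forall>t\<in>S. dist (f n t) (l t) < e"
    by eventually_elim (use assms(1) le_less_trans in blast)
qed

section \<open>Paths with regular area\<close>

text \<open>
  The deterministic content of what holds almost surely for Brownian paths.  The two bounds on Riemann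
  sums are used for different purposes: \<open>double\<close>, restricted to powers of two, constructs the
  integral as a limit of dyadic Riemann sums, and \<open>dyadic\<close> compares the Riemann sum along an arbitrary
  grid with a dyadic one so fine that its distance from the limit is negligible.
\<close>

locale area_regular_path =
  fixes T p C :: real and X :: "real \<Rightarrow> real ^ 'd"
  assumes T: "0 < T" and p: "2 < p" "p < 3" and C: "0 \<le> C"
    and cont: "continuous_on {0..T} X"
    and incr: "\<And>m k. k < 2 ^ m \<Longrightarrow>
      norm (X (grid T (2 ^ m) (Suc k)) - X (grid T (2 ^ m) k)) \<le> C * (2 powr - (1 / p)) ^ m"
    and double: "\<And>N k l. 0 < N \<Longrightarrow> k \<le> l \<Longrightarrow> l \<le> N \<Longrightarrow>
      norm (riemann_diff T (2 * N) N X (grid T N l) - riemann_diff T (2 * N) N X (grid T N k))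
        \<le> C * real N powr (1 / 2 - 2 / p) * sqrt (grid T N l - grid T N k)"
    and dyadic: "\<And>N k l. 0 < N \<Longrightarrow> k \<le> l \<Longrightarrow> l \<le> N \<Longrightarrow>
      norm (riemann_diff T (2 ^ N) N X (grid T N l) - riemann_diff T (2 ^ N) N X (grid T N k))
        \<le> C * real N powr (1 / 2 - 2 / p) * sqrt (grid T N l - grid T N k)"
begin

abbreviation R :: "nat \<Rightarrow> real \<Rightarrow> real ^ 'd ^ 'd" where
  "R N \<equiv> riemann_sum N (grid T N) X"

text \<open>
  The factor \<open>N\<^sup>-\<^sup>\<epsilon>\<close>, \<open>\<epsilon> = 2/p - 1/2\<close>, at \<open>N = 2\<close>: the geometric rate of convergence of the dyadic Riemann sums.
\<close>

definition \<rho> :: real where "\<rho> = 2 powr (1 / 2 - 2 / p)"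

lemma exponent: "2 / p < 1" "1 / 2 < 2 / p"
  using p by (auto simp: field_simps)

lemma \<rho>: "0 < \<rho>" "\<rho> < 1"
  using exponent by (auto simp: \<rho>_def powr_less_one)

lemma \<rho>_power: "\<rho> ^ m = real (2 ^ m) powr (1 / 2 - 2 / p)"
proof -
  have "\<rho> ^ m = \<rho> powr real m" using \<rho> by (simp add: powr_realpow)
  also have "\<dots> = (2 powr real m) powr (1 / 2 - 2 / p)" by (simp only: \<rho>_def powr_powr mult.commute)
  also have "2 powr real m = real (2 ^ m)" by (simp add: powr_realpow)
  finally show ?thesis .
qed

lemma hoelder: "\<exists>K\<ge>0. \<forall>s t. 0 \<le> s \<longrightarrow> s \<le> t \<longrightarrow> t \<le> T \<longrightarrow> norm (X t - X s) \<le> K * (t - s) powr (1 / p)"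
proof (rule hoelder_if_dyadic_hoelder)
  show "norm (X t - X s) \<le> norm (X u - X s) + norm (X t - X u)" for s u t
    using norm_triangle_ineq[of "X u - X s" "X t - X u"] by simp
  show "continuous_on ({0..T} \<times> {0..T}) (\<lambda>(s, t). norm (X t - X s))"
    unfolding case_prod_beta
    by (intro continuous_intros continuous_on_compose2[OF cont]) auto
  show "norm (X (grid T (2 ^ m) (Suc k)) - X (grid T (2 ^ m) k)) \<le> C * (2 powr - (1 / p)) ^ m"
    if "k < 2 ^ m" for k m using incr[OF that] .
qed (use T p C in auto)

lemma R_0: "R N 0 = 0"
  using T by (intro riemann_sum_0) (simp add: grid_def)

lemma R_increment:
  assumes "k < N" "grid T N k \<le> s" "s \<le> t" "t \<le> grid T N (Suc k)"
  shows "R N t - R N s = X (grid T N k) \<otimes>\<^sub>v (X t - X s)"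
  using assms T by (intro riemann_sum_grid_increment) auto

text \<open>
  At grid points this is the assumption \<open>double\<close>.  Within a cell with left end \<open>s\<close> and
  midpoint \<open>u\<close>, halving the cell adds \<open>(X\<^sub>u - X\<^sub>s) \<otimes> (X\<^sub>t - X\<^sub>u)\<close> if \<open>t > u\<close>, and nothing otherwise; by
  Hoelder continuity this is of order \<open>N\<^sup>-\<^sup>2\<^sup>/\<^sup>p\<close>, which is smaller than \<open>N\<^sup>-\<^sup>\<epsilon>\<close>.
\<close>

lemma R_double:
  obtains B where "0 \<le> B" "\<And>m t. t \<in> {0..T} \<Longrightarrow> norm (R (2 ^ Suc m) t - R (2 ^ m) t) \<le> B * \<rho> ^ m"
proof -
  obtain K where K: "0 \<le> K" "\<And>s t. 0 \<le> s \<Longrightarrow> s \<le> t \<Longrightarrow> t \<le> T \<Longrightarrow> norm (X t - X s) \<le> K * (t - s) powr (1 / p)"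
    using hoelder by auto
  define B where "B = C * sqrt T + K\<^sup>2 * T powr (2 / p)"
  have "norm (R (2 ^ Suc m) t - R (2 ^ m) t) \<le> B * \<rho> ^ m" if t: "t \<in> {0..T}" for m t
  proof -
    define N :: nat where "N = 2 ^ m"
    have N: "0 < N" "1 \<le> real N" by (auto simp: N_def)
    obtain k where k: "k < N" "grid T N k \<le> t" "t \<le> grid T N (Suc k)"
      using grid_cell[OF T N(1) t] by blast
    define s u where "s = grid T N k" and "u = grid T (2 * N) (Suc (2 * k))"
    have s: "s = grid T (2 * N) (2 * k)" "grid T N (Suc k) = grid T (2 * N) (Suc (Suc (2 * k)))"
      using grid_refine[of 2 T N k] grid_refine[of 2 T N "Suc k"] by (simp_all add: s_def mult.commute)
    have su: "0 \<le> s" "s \<le> u" "u \<le> grid T N (Suc k)" "s \<le> t"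
      using k T grid_in[of T k N] grid_mono[of T "2 * k" "Suc (2 * k)" "2 * N"]
        grid_mono[of T "Suc (2 * k)" "Suc (Suc (2 * k))" "2 * N"] unfolding u_def s(2) s(1)[symmetric]
      by (auto simp: s_def)
    have gap: "grid T N (Suc k) - s = T / N" by (simp add: s_def grid_diff)
    have split: "R (2 * N) t - R N t = (riemann_diff T (2 * N) N X s - riemann_diff T (2 * N) N X 0)
        + ((R (2 * N) t - R (2 * N) s) - X s \<otimes>\<^sub>v (X t - X s))"
    proof -
      have "R N t - R N s = X s \<otimes>\<^sub>v (X t - X s)"
        using R_increment[OF k(1) _ su(4) k(3)] by (simp add: s_def)
      then have "R N t = R N s + X s \<otimes>\<^sub>v (X t - X s)" by (simp add: algebra_simps)
      then show ?thesis by (simp add: riemann_diff_def R_0)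
    qed
    have one: "norm (riemann_diff T (2 * N) N X s - riemann_diff T (2 * N) N X 0) \<le> C * sqrt T * \<rho> ^ m"
    proof -
      have "norm (riemann_diff T (2 * N) N X s - riemann_diff T (2 * N) N X 0) \<le> C * real N powr (1 / 2 - 2 / p) * sqrt (s - 0)"
        using double[OF N(1), of 0 k] k by (simp add: s_def)
      also have "\<dots> \<le> C * real N powr (1 / 2 - 2 / p) * sqrt T"
        using C k t su by (intro mult_left_mono) auto
      finally show ?thesis by (simp add: \<rho>_power N_def mult_ac)
    qed
    have "norm ((R (2 * N) t - R (2 * N) s) - X s \<otimes>\<^sub>v (X t - X s)) \<le> K\<^sup>2 * (T / N) powr (2 / p)"
    proof (cases "t \<le> u")
      case True
      then have "R (2 * N) t - R (2 * N) s = X s \<otimes>\<^sub>v (X t - X s)"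
        using R_increment[of "2 * k" "2 * N" s t] k su by (simp add: s(1) u_def)
      then show ?thesis by simp
    next
      case False
      have "R (2 * N) u - R (2 * N) s = X s \<otimes>\<^sub>v (X u - X s)"
        using R_increment[of "2 * k" "2 * N" s u] k su by (simp add: s(1) u_def)
      moreover have "R (2 * N) t - R (2 * N) u = X u \<otimes>\<^sub>v (X t - X u)"
        using R_increment[of "Suc (2 * k)" "2 * N" u t] k su False by (simp add: s(2) u_def)
      ultimately have "(R (2 * N) t - R (2 * N) s) - X s \<otimes>\<^sub>v (X t - X s) = (X u - X s) \<otimes>\<^sub>v (X t - X u)"
        by (simp add: tensor.diff_left tensor.diff_right algebra_simps)
      then have "norm ((R (2 * N) t - R (2 * N) s) - X s \<otimes>\<^sub>v (X t - X s)) = norm (X u - X s) * norm (X t - X u)"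
        by (simp add: norm_tensor)
      also have "\<dots> \<le> (K * (T / N) powr (1 / p)) * (K * (T / N) powr (1 / p))"
      proof (rule mult_mono)
        have "norm (X u - X s) \<le> K * (u - s) powr (1 / p)" using su t False by (intro K) auto
        also have "\<dots> \<le> K * (T / N) powr (1 / p)"
          using su gap p K(1) by (intro mult_left_mono powr_mono2) auto
        finally show "norm (X u - X s) \<le> K * (T / N) powr (1 / p)" .
        have "norm (X t - X u) \<le> K * (t - u) powr (1 / p)" using su t False by (intro K) auto
        also have "\<dots> \<le> K * (T / N) powr (1 / p)"
          using su gap p K(1) k False by (intro mult_left_mono powr_mono2) auto
        finally show "norm (X t - X u) \<le> K * (T / N) powr (1 / p)" .
      qed (use K(1) in auto)
      also have "\<dots> = K\<^sup>2 * ((T / N) powr (1 / p) * (T / N) powr (1 / p))"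
        by (simp add: power2_eq_square)
      also have "(T / N) powr (1 / p) * (T / N) powr (1 / p) = (T / N) powr (2 / p)"
        by (simp add: powr_add[symmetric])
      finally show ?thesis .
    qed
    also have "(T / N) powr (2 / p) \<le> T powr (2 / p) * \<rho> ^ m"
    proof -
      have "(T / N) powr (2 / p) = T powr (2 / p) * real N powr (- (2 / p))"
        using T by (simp add: powr_divide powr_minus_divide)
      also have "\<dots> \<le> T powr (2 / p) * real N powr (1 / 2 - 2 / p)"
        using N by (intro mult_left_mono powr_mono) auto
      finally show ?thesis by (simp add: \<rho>_power N_def)
    qed
    finally have "norm ((R (2 * N) t - R (2 * N) s) - X s \<otimes>\<^sub>v (X t - X s)) \<le> K\<^sup>2 * (T powr (2 / p) * \<rho> ^ m)"
      by (simp add: mult_left_mono)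
    with one have "norm (R (2 * N) t - R N t) \<le> C * sqrt T * \<rho> ^ m + K\<^sup>2 * (T powr (2 / p) * \<rho> ^ m)"
      unfolding split by (intro norm_triangle_mono)
    then show ?thesis by (simp add: B_def N_def algebra_simps)
  qed
  moreover have "0 \<le> B" using C T by (simp add: B_def)
  ultimately show ?thesis using that by blast
qed

lemma R_dyadic_limit:
  obtains J B where "0 \<le> B" "\<And>m t. t \<in> {0..T} \<Longrightarrow> norm (J t - R (2 ^ m) t) \<le> B * \<rho> ^ m"
    and "continuous_on {0..T} J" and "J 0 = 0"
    and "\<And>t. t \<in> {0..T} \<Longrightarrow> (\<lambda>m. R (2 ^ m) t) \<longlonglongrightarrow> J t"
proof -
  obtain B where B: "0 \<le> B" "\<And>m t. t \<in> {0..T} \<Longrightarrow> norm (R (2 ^ Suc m) t - R (2 ^ m) t) \<le> B * \<rho> ^ m"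
    using R_double by blast
  define J where "J t = lim (\<lambda>m. R (2 ^ m) t)" for t
  have lim: "(\<lambda>m. R (2 ^ m) t) \<longlonglongrightarrow> J t" if "t \<in> {0..T}" for t
    unfolding J_def convergent_LIMSEQ_iff[symmetric]
    using geometric_increments(1)[OF B(2)[OF that]] \<rho> by simp
  have J: "norm (J t - R (2 ^ m) t) \<le> B / (1 - \<rho>) * \<rho> ^ m" if "t \<in> {0..T}" for m t
    using geometric_increments(2)[OF B(2)[OF that] _ _ lim[OF that], of m] \<rho> by simp
  have "(\<lambda>m. B / (1 - \<rho>) * \<rho> ^ m) \<longlonglongrightarrow> B / (1 - \<rho>) * 0"
    using \<rho> by (intro tendsto_intros LIMSEQ_power_zero) auto
  then have "uniform_limit {0..T} (\<lambda>m. R (2 ^ m)) J sequentially"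
    using J by (intro uniform_limit_if_bounded[of _ _ _ "\<lambda>m. B / (1 - \<rho>) * \<rho> ^ m"])
      (auto simp: dist_norm norm_minus_commute)
  moreover have "continuous_on {0..T} (R N)" for N
    using T by (intro continuous_on_riemann_sum cont) (simp add: grid_def)
  ultimately have "continuous_on {0..T} J"
    by (intro uniform_limit_theorem[where F = sequentially]) auto
  moreover have "J 0 = 0" unfolding J_def R_0 by (rule limI) simp
  ultimately show ?thesis using that[of "B / (1 - \<rho>)" J] J B(1) \<rho> lim by simp
qed

text \<open>
  The area of the limit \<open>J\<close> is Hoelder continuous of twice the exponent of the path.  On a dyadic
  interval of level \<open>n\<close> the area of the Riemann sum of level \<open>n\<close> vanishes, so only the later
  refinements contribute.  Chaining then yields all intervals, because the
  homogeneous norm \<open>max |X\<^sub>t - X\<^sub>s| |A\<^sub>s\<^sub>,\<^sub>t|\<^sup>1\<^sup>/\<^sup>2\<close> is subadditive.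
\<close>

lemma area_hoelder:
  obtains J B K where "0 \<le> B" "0 \<le> K" "J 0 = 0"
    and "\<And>m t. t \<in> {0..T} \<Longrightarrow> norm (J t - R (2 ^ m) t) \<le> B * \<rho> ^ m"
    and "\<And>s t. 0 \<le> s \<Longrightarrow> s \<le> t \<Longrightarrow> t \<le> T \<Longrightarrow>
           norm (J t - J s - X s \<otimes>\<^sub>v (X t - X s)) \<le> K * (t - s) powr (2 / p)"
proof (rule R_dyadic_limit)
  fix J B assume B: "0 \<le> B" and J: "\<And>m t. t \<in> {0..T} \<Longrightarrow> norm (J t - R (2 ^ m) t) \<le> B * \<rho> ^ m"
    and contJ: "continuous_on {0..T} J" and J0: "J 0 = 0"
    and limJ: "\<And>t. t \<in> {0..T} \<Longrightarrow> (\<lambda>m. R (2 ^ m) t) \<longlonglongrightarrow> J t"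
  define A where "A s t = J t - J s - X s \<otimes>\<^sub>v (X t - X s)" for s t
  define E where "E = C * sqrt T / (1 - \<rho>)"
  have E: "0 \<le> E" using C T \<rho> by (simp add: E_def)
  have dyA: "norm (A (grid T (2 ^ n) k) (grid T (2 ^ n) (Suc k))) \<le> E * (2 powr - (2 / p)) ^ n"
    if k: "k < 2 ^ n" for n k
  proof -
    let ?s = "grid T (2 ^ n) k" and ?t = "grid T (2 ^ n) (Suc k)"
    define f where "f i = R (2 ^ (n + i)) ?t - R (2 ^ (n + i)) ?s" for i
    have st: "?s \<in> {0..T}" "?t \<in> {0..T}" using grid_in[of T _ "2 ^ n"] T k by auto
    have "f \<longlonglongrightarrow> J ?t - J ?s"
      using LIMSEQ_ignore_initial_segment[OF limJ[OF st(2)], of n] LIMSEQ_ignore_initial_segment[OF limJ[OF st(1)], of n]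
      unfolding f_def by (intro tendsto_diff) (simp_all add: add.commute)
    moreover have "norm (f (Suc i) - f i) \<le> C * \<rho> ^ n * sqrt (T / 2 ^ n) * \<rho> ^ i" for i
    proof -
      have g: "grid T (2 ^ (n + i)) (j * 2 ^ i) = grid T (2 ^ n) j" for j
        using grid_refine[of "2 ^ i" T "2 ^ n" j] by (simp add: power_add)
      have "Suc k * 2 ^ i \<le> 2 ^ n * 2 ^ i" using k by (intro mult_right_mono) auto
      then have "norm (riemann_diff T (2 * 2 ^ (n + i)) (2 ^ (n + i)) X ?t - riemann_diff T (2 * 2 ^ (n + i)) (2 ^ (n + i)) X ?s)
          \<le> C * real (2 ^ (n + i)) powr (1 / 2 - 2 / p) * sqrt (?t - ?s)"
        using double[of "2 ^ (n + i)" "k * 2 ^ i" "Suc k * 2 ^ i"] by (simp add: power_add del: mult_Suc flip: g)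
      also have "?t - ?s = T / 2 ^ n" by (simp add: grid_diff)
      finally show ?thesis
        unfolding \<rho>_power[symmetric] by (simp add: f_def riemann_diff_def diff_diff_swap power_add mult_ac)
    qed
    ultimately have "norm (J ?t - J ?s - f 0) \<le> C * \<rho> ^ n * sqrt (T / 2 ^ n) * \<rho> ^ 0 / (1 - \<rho>)"
      using \<rho> by (intro geometric_increments(2)) auto
    moreover have "f 0 = X ?s \<otimes>\<^sub>v (X ?t - X ?s)"
      unfolding f_def using R_increment[of k "2 ^ n" ?s ?t] k T by (simp add: grid_mono)
    moreover have "C * \<rho> ^ n * sqrt (T / 2 ^ n) * \<rho> ^ 0 / (1 - \<rho>) = E * (2 powr - (2 / p)) ^ n"
    proof -
      have "2 powr - (2 / p) = \<rho> * (2 powr - (1 / 2))" by (simp add: \<rho>_def powr_add[symmetric])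
      also have "2 powr - (1 / 2) = 1 / sqrt (2::real)"
        by (simp add: powr_minus powr_half_sqrt inverse_eq_divide)
      finally show ?thesis
        by (simp add: E_def power_mult_distrib power_divide real_sqrt_divide real_sqrt_power mult_ac)
    qed
    ultimately show ?thesis by (simp add: A_def)
  qed
  \<comment> \<open>the square root makes both levels scale alike\<close>
  define d where "d s t = max (norm (X t - X s)) (sqrt (norm (A s t)))" for s t
  have "\<exists>K\<ge>0. \<forall>s t. 0 \<le> s \<longrightarrow> s \<le> t \<longrightarrow> t \<le> T \<longrightarrow> d s t \<le> K * (t - s) powr (1 / p)"
  proof (rule hoelder_if_dyadic_hoelder[of T "1 / p" "max C (sqrt E)" d])
    fix s u t :: real assume "0 \<le> s" "s \<le> u" "u \<le> t" "t \<le> T"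
    \<comment> \<open>Chen's relation\<close>
    have "A s t = A s u + A u t + (X u - X s) \<otimes>\<^sub>v (X t - X u)"
      by (simp add: A_def tensor.diff_left tensor.diff_right algebra_simps)
    then have "norm (A s t) \<le> norm (A s u) + norm (A u t) + norm (X u - X s) * norm (X t - X u)"
      using norm_triangle_ineq[of "A s u + A u t" "(X u - X s) \<otimes>\<^sub>v (X t - X u)"]
        norm_triangle_ineq[of "A s u" "A u t"] unfolding norm_tensor by simp
    also have "\<dots> \<le> (d s u)\<^sup>2 + (d u t)\<^sup>2 + d s u * d u t"
    proof (intro add_mono mult_mono)
      have "norm (A s u) = (sqrt (norm (A s u)))\<^sup>2" for s u by simp
      also have "\<dots> s u \<le> (d s u)\<^sup>2" for s u by (intro power_mono) (auto simp: d_def)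
      finally show "norm (A s u) \<le> (d s u)\<^sup>2" "norm (A u t) \<le> (d u t)\<^sup>2" by auto
    qed (auto simp: d_def le_max_iff_disj)
    also have "\<dots> \<le> (d s u + d u t)\<^sup>2"
    proof -
      have "0 \<le> d s u * d u t" by (auto simp: d_def le_max_iff_disj)
      then show ?thesis by (simp add: power2_sum)
    qed
    finally have "sqrt (norm (A s t)) \<le> d s u + d u t"
      by (intro real_le_lsqrt) (auto simp: d_def le_max_iff_disj)
    moreover have "norm (X t - X s) \<le> d s u + d u t"
      using norm_triangle_ineq[of "X u - X s" "X t - X u"] by (simp add: d_def)
    ultimately show "d s t \<le> d s u + d u t" by (simp add: d_def)
  next
    fix k m :: nat assume k: "k < 2 ^ m"
    let ?s = "grid T (2 ^ m) k" and ?t = "grid T (2 ^ m) (Suc k)" and ?r = "(2 powr - (1 / p)) ^ m"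
    have "norm (X ?t - X ?s) \<le> max C (sqrt E) * ?r"
      using incr[OF k] by (rule order.trans) (intro mult_right_mono, auto)
    moreover have "sqrt (norm (A ?s ?t)) \<le> max C (sqrt E) * ?r"
    proof -
      have "(2 powr - (2 / p)) ^ m = ?r\<^sup>2"
        by (simp add: power2_eq_square power_mult_distrib[symmetric] powr_add[symmetric])
      then have "sqrt (norm (A ?s ?t)) \<le> sqrt (E * ?r\<^sup>2)"
        using dyA[OF k] by simp
      also have "\<dots> = sqrt E * ?r" using E by (simp add: real_sqrt_mult)
      also have "\<dots> \<le> max C (sqrt E) * ?r" by (intro mult_right_mono) auto
      finally show ?thesis .
    qed
    ultimately show "d ?s ?t \<le> max C (sqrt E) * ?r" by (simp add: d_def)
  next
    show "continuous_on ({0..T} \<times> {0..T}) (\<lambda>(s, t). d s t)"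
      unfolding case_prod_beta d_def A_def
      by (intro continuous_intros continuous_on_max tensor.continuous_on continuous_on_compose2[OF cont]
          continuous_on_compose2[OF contJ]) auto
  qed (use T p C in \<open>auto simp: d_def A_def tensor.zero_right le_max_iff_disj\<close>)
  then obtain K where K: "0 \<le> K" "\<And>s t. 0 \<le> s \<Longrightarrow> s \<le> t \<Longrightarrow> t \<le> T \<Longrightarrow> d s t \<le> K * (t - s) powr (1 / p)"
    by auto
  have "norm (A s t) \<le> K\<^sup>2 * (t - s) powr (2 / p)" if "0 \<le> s" "s \<le> t" "t \<le> T" for s t
  proof -
    have "norm (A s t) = (sqrt (norm (A s t)))\<^sup>2" by simp
    also have "\<dots> \<le> (K * (t - s) powr (1 / p))\<^sup>2"
      using K(2)[OF that] by (intro power_mono) (auto simp: d_def)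
    also have "\<dots> = K\<^sup>2 * (t - s) powr (2 / p)"
      by (simp add: power2_eq_square powr_add[symmetric] mult_ac flip: mult.assoc)
    finally show ?thesis .
  qed
  then show ?thesis using that[OF B _ J0 J, of "K\<^sup>2"] by (simp add: A_def)
qed

text \<open>
  The area of the Riemann sum differs from that of \<open>J\<close> by at most
  \<open>C N\<^sup>-\<^sup>\<epsilon> (t - s)\<^sup>1\<^sup>/\<^sup>2 + 2 B \<rho>\<^sup>N\<close>: the assumption \<open>dyadic\<close> compares \<open>R N\<close> with \<open>R (2\<^sup>N)\<close>, and
  the dyadic sums converge geometrically.  Distinct grid points are at least \<open>T/N\<close> apart, which turns
  negative powers of \<open>N\<close> into powers of \<open>t - s\<close>.
\<close>

lemma riemann_sums_grid:
  obtains J e K where "0 \<le> K" "e \<longlonglongrightarrow> 0"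
    and "\<And>N t. 0 < N \<Longrightarrow> t \<in> {0..T} \<Longrightarrow> norm (R N t - J t) \<le> e N"
    and "\<And>N k l. k < l \<Longrightarrow> l \<le> N \<Longrightarrow>
           norm (R N (grid T N l) - R N (grid T N k) - X (grid T N k) \<otimes>\<^sub>v (X (grid T N l) - X (grid T N k)))
             \<le> K * (grid T N l - grid T N k) powr (2 / p)"
proof (rule area_hoelder)
  fix J B K assume B: "0 \<le> B" and K: "0 \<le> K" and J0: "J 0 = 0"
    and J: "\<And>m t. t \<in> {0..T} \<Longrightarrow> norm (J t - R (2 ^ m) t) \<le> B * \<rho> ^ m"
    and A: "\<And>s t. 0 \<le> s \<Longrightarrow> s \<le> t \<Longrightarrow> t \<le> T \<Longrightarrow>
           norm (J t - J s - X s \<otimes>\<^sub>v (X t - X s)) \<le> K * (t - s) powr (2 / p)"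
  have err: "norm ((R N (grid T N l) - R N (grid T N k)) - (J (grid T N l) - J (grid T N k)))
      \<le> C * real N powr (1 / 2 - 2 / p) * sqrt (grid T N l - grid T N k) + 2 * B * \<rho> ^ N"
    if kl: "0 < N" "k \<le> l" "l \<le> N" for N k l
  proof -
    let ?s = "grid T N k" and ?t = "grid T N l" and ?D = "riemann_diff T (2 ^ N) N X"
    have st: "?s \<in> {0..T}" "?t \<in> {0..T}" using grid_in[of T k N] grid_in[of T l N] T kl by auto
    have split: "(R N ?t - R N ?s) - (J ?t - J ?s) = - (?D ?t - ?D ?s) - (J ?t - R (2 ^ N) ?t) + (J ?s - R (2 ^ N) ?s)"
      by (simp add: riemann_diff_def)
    have "norm ((R N ?t - R N ?s) - (J ?t - J ?s)) \<le> norm (?D ?t - ?D ?s) + norm (J ?t - R (2 ^ N) ?t) + norm (J ?s - R (2 ^ N) ?s)"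
      using norm_triangle_ineq[of "- (?D ?t - ?D ?s) - (J ?t - R (2 ^ N) ?t)" "J ?s - R (2 ^ N) ?s"]
        norm_triangle_ineq4[of "- (?D ?t - ?D ?s)" "J ?t - R (2 ^ N) ?t"]
      unfolding split norm_minus_cancel by linarith
    also have "\<dots> \<le> C * real N powr (1 / 2 - 2 / p) * sqrt (?t - ?s) + B * \<rho> ^ N + B * \<rho> ^ N"
      by (rule add_mono[OF add_mono[OF dyadic[OF kl] J[OF st(2)]] J[OF st(1)]])
    finally show ?thesis by simp
  qed
  define e where "e N = C * real N powr (1 / 2 - 2 / p) * sqrt T + 2 * B * \<rho> ^ N
      + K * (T powr (2 / p) * real N powr - (2 / p))" for N
  have "e \<longlonglongrightarrow> C * 0 * sqrt T + 2 * B * 0 + K * (T powr (2 / p) * 0)"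
    unfolding e_def using \<rho> exponent p
    by (intro tendsto_intros LIMSEQ_power_zero tendsto_neg_powr filterlim_real_sequentially) auto
  then have e: "e \<longlonglongrightarrow> 0" by simp
  have unif: "norm (R N t - J t) \<le> e N" if N: "0 < N" and t: "t \<in> {0..T}" for N t
  proof -
    obtain k where k: "k < N" "grid T N k \<le> t" "t \<le> grid T N (Suc k)"
      using grid_cell[OF T N t] by blast
    let ?s = "grid T N k"
    have s: "0 \<le> ?s" "?s \<le> T" using grid_in[of T k N] T k by auto
    have "R N t - R N ?s = X ?s \<otimes>\<^sub>v (X t - X ?s)"
      using R_increment[OF k(1) _ k(2,3)] by simp
    then have split: "R N t - J t = (R N ?s - R N 0 - (J ?s - J 0)) - (J t - J ?s - X ?s \<otimes>\<^sub>v (X t - X ?s))"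
      by (simp add: R_0 J0 algebra_simps)
    have "norm (R N t - J t) \<le> norm (R N ?s - R N 0 - (J ?s - J 0)) + norm (J t - J ?s - X ?s \<otimes>\<^sub>v (X t - X ?s))"
      unfolding split by (rule norm_triangle_ineq4)
    also have "norm (R N ?s - R N 0 - (J ?s - J 0)) \<le> C * real N powr (1 / 2 - 2 / p) * sqrt T + 2 * B * \<rho> ^ N"
    proof -
      have "norm (R N ?s - R N 0 - (J ?s - J 0)) \<le> C * real N powr (1 / 2 - 2 / p) * sqrt (?s - 0) + 2 * B * \<rho> ^ N"
        using err[OF N, of 0 k] k by simp
      also have "\<dots> \<le> C * real N powr (1 / 2 - 2 / p) * sqrt T + 2 * B * \<rho> ^ N"
        using s C by (intro add_right_mono mult_left_mono) auto
      finally show ?thesis .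
    qed
    also have "norm (J t - J ?s - X ?s \<otimes>\<^sub>v (X t - X ?s)) \<le> K * (T powr (2 / p) * real N powr - (2 / p))"
    proof -
      have "norm (J t - J ?s - X ?s \<otimes>\<^sub>v (X t - X ?s)) \<le> K * (t - ?s) powr (2 / p)"
        using s k t by (intro A) auto
      also have "\<dots> \<le> K * (grid T N (Suc k) - ?s) powr (2 / p)"
        using k p K by (intro mult_left_mono powr_mono2) auto
      also have "grid T N (Suc k) - ?s = T / N" by (simp add: grid_diff)
      also have "(T / N) powr (2 / p) = T powr (2 / p) * real N powr - (2 / p)"
        using T by (simp add: powr_divide powr_minus_divide)
      finally show ?thesis .
    qed
    finally show ?thesis by (simp add: e_def)
  qed
  have "(\<lambda>N. real N * \<rho> ^ N) \<longlonglongrightarrow> 0"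
    using \<rho> by (intro powser_times_n_limit_0) auto
  from convergent_imp_Bseq[OF convergentI[OF this]]
  obtain D where D: "0 < D" "\<And>N. norm (real N * \<rho> ^ N) \<le> D"
    unfolding Bseq_def by blast
  define K' where "K' = K + C * T powr (1 / 2 - 2 / p) + 2 * B * D * T powr - (2 / p)"
  have bound: "norm (R N (grid T N l) - R N (grid T N k) - X (grid T N k) \<otimes>\<^sub>v (X (grid T N l) - X (grid T N k)))
             \<le> K' * (grid T N l - grid T N k) powr (2 / p)"
    if kl: "k < l" "l \<le> N" for N k l
  proof -
    let ?s = "grid T N k" and ?t = "grid T N l"
    define r where "r = ?t - ?s"
    have N: "0 < N" using kl by simp
    have st: "0 \<le> ?s" "?s \<le> ?t" "?t \<le> T" using grid_in[of T k N] grid_in[of T l N] grid_mono[of T k l N] kl T by auto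
    have rN: "1 / N \<le> r / T"
      unfolding r_def using kl T by (simp add: grid_diff divide_right_mono)
    have "0 < 1 / real N" using N by simp
    with rN have "0 < r / T" by (rule less_le_trans[rotated])
    then have r: "0 < r" using T by (simp add: zero_less_divide_iff)
    have one: "real N powr (1 / 2 - 2 / p) * sqrt r \<le> T powr (1 / 2 - 2 / p) * r powr (2 / p)"
    proof -
      define a where "a = 2 / p - 1 / 2"
      have a: "0 < a" "1 / 2 - 2 / p = - a" "2 / p = a + 1 / 2" using exponent by (auto simp: a_def)
      have "real N powr - a = (1 / real N) powr a" by (simp add: powr_minus_divide powr_divide)
      also have "\<dots> \<le> (r / T) powr a" using rN a(1) by (intro powr_mono2) auto
      also have "\<dots> = T powr - a * r powr a" using r T by (simp add: powr_minus_divide powr_divide)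
      finally have "real N powr - a * sqrt r \<le> T powr - a * r powr a * sqrt r"
        using r by (intro mult_right_mono) auto
      also have "\<dots> = T powr - a * r powr (a + 1 / 2)"
        using r by (simp only: powr_add powr_half_sqrt less_imp_le mult.assoc)
      finally show ?thesis unfolding a(2) unfolding a(3) .
    qed
    have two: "\<rho> ^ N \<le> D * T powr - (2 / p) * r powr (2 / p)"
    proof -
      have "\<rho> ^ N \<le> D * (1 / N)" using D(2)[of N] N \<rho> by (simp add: field_simps)
      also have "1 / N \<le> (1 / N) powr (2 / p)"
        using powr_mono'[of "2 / p" 1 "1 / real N"] exponent N by simp
      also have "\<dots> \<le> (r / T) powr (2 / p)" using rN p by (intro powr_mono2) auto
      also have "\<dots> = T powr - (2 / p) * r powr (2 / p)"
        using r T by (simp add: powr_divide powr_minus_divide)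
      finally show ?thesis using D(1) by (simp add: mult_left_mono)
    qed
    have split: "R N ?t - R N ?s - X ?s \<otimes>\<^sub>v (X ?t - X ?s)
        = (J ?t - J ?s - X ?s \<otimes>\<^sub>v (X ?t - X ?s)) + ((R N ?t - R N ?s) - (J ?t - J ?s))"
      by simp
    have "norm (R N ?t - R N ?s - X ?s \<otimes>\<^sub>v (X ?t - X ?s))
        \<le> K * r powr (2 / p) + (C * real N powr (1 / 2 - 2 / p) * sqrt r + 2 * B * \<rho> ^ N)"
      unfolding r_def split
      by (rule norm_triangle_mono[OF A[OF st] err[OF N less_imp_le[OF kl(1)] kl(2)]])
    also have "\<dots> \<le> K * r powr (2 / p) + (C * (T powr (1 / 2 - 2 / p) * r powr (2 / p))
        + 2 * B * (D * T powr - (2 / p) * r powr (2 / p)))"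
      using one two B C by (intro add_left_mono add_mono) (auto simp: mult.assoc intro!: mult_left_mono)
    also have "\<dots> = K' * r powr (2 / p)" by (simp add: K'_def algebra_simps)
    finally show ?thesis by (simp add: r_def)
  qed
  have "0 \<le> K'" using K B C D by (simp add: K'_def)
  then show ?thesis by (rule that[OF _ e unif bound])
qed

end

section \<open>Property (RIE) for paths with regular area\<close>

lemma riemann_sum_cong:
  "(\<And>k. k \<le> N \<Longrightarrow> u k = v k) \<Longrightarrow> riemann_sum N u X = riemann_sum N v X"
  unfolding riemann_sum_def by (intro ext sum.cong) auto

lemma discretized_cong:
  "(\<And>k. k \<le> N \<Longrightarrow> u k = v k) \<Longrightarrow> discretized T N u X = discretized T N v X"
  unfolding discretized_def by (intro ext arg_cong2[where f = "(+)"] sum.cong) auto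

lemma discretized_grid_cell:
  assumes T: "0 < T" and k: "k < N" "grid T N k \<le> t" "t < grid T N (Suc k)"
  shows "discretized T N (grid T N) X t = X (grid T N k)"
proof -
  have mono: "grid T N i \<le> grid T N j" if "i \<le> j" for i j using grid_mono that T by simp
  have "t < T" using k mono[of "Suc k" N] grid_last[of N T] by simp
  moreover have "(\<Sum>i<N. indicator {grid T N i..<grid T N (Suc i)} t *\<^sub>R X (grid T N i))
      = (\<Sum>i<N. if i = k then X (grid T N k) else 0)"
  proof (rule sum.cong[OF HOL.refl])
    fix i
    consider "i < k" | "i = k" | "k < i" by linarith
    then show "indicator {grid T N i..<grid T N (Suc i)} t *\<^sub>R X (grid T N i) = (if i = k then X (grid T N k) else 0)"
    proof cases
      case 1
      then show ?thesis using mono[of "Suc i" k] k by simp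
    next
      case 3
      then show ?thesis using mono[of "Suc k" i] k by simp
    qed (use k in simp)
  qed
  ultimately show ?thesis using k by (simp add: discretized_def)
qed

lemma discretized_grid_last:
  assumes T: "0 < T"
  shows "discretized T N (grid T N) X T = X T"
proof -
  have "grid T N (Suc i) \<le> T" if "i < N" for i using grid_in[of T "Suc i" N] T that by auto
  then have "(\<Sum>i<N. indicator {grid T N i..<grid T N (Suc i)} T *\<^sub>R X (grid T N i)) = 0"
    by (intro sum.neutral) (auto simp: indicator_def not_less)
  then show ?thesis by (simp add: discretized_def)
qed

lemma cadlag_if_continuous_on:
  assumes "continuous_on {0..T} X"
  shows "cadlag T X"
proof -
  have right: "(X \<longlongrightarrow> X t) (at_right t)" if t: "t \<in> {0..<T}" for t
  proof -
    have "continuous_on {t..T} X" using t by (intro continuous_on_subset[OF assms]) auto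
    then have "(X \<longlongrightarrow> X t) (at t within {t..T})" using t by (auto simp: continuous_on_def)
    then show ?thesis using t by (simp add: at_within_Icc_at_right)
  qed
  have left: "(X \<longlongrightarrow> X t) (at_left t)" if t: "t \<in> {0<..T}" for t
  proof -
    have "continuous_on {0..t} X" using t by (intro continuous_on_subset[OF assms]) auto
    then have "(X \<longlongrightarrow> X t) (at t within {0..t})" using t by (auto simp: continuous_on_def)
    then show ?thesis using t by (simp add: at_within_Icc_at_left)
  qed
  from right left show ?thesis unfolding cadlag_def by blast
qed

lemma ennreal_quotient_le_half:
  assumes "0 \<le> a" "2 * a \<le> b"
  shows "ennreal a / ennreal b \<le> ennreal (1 / 2)"
proof (cases "b = 0")
  case True
  then show ?thesis using assms by simp
next
  case False
  then have "0 < b" using assms by simp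
  then have "a / b \<le> 1 / 2" using assms by (simp add: field_simps)
  then have "ennreal (a / b) \<le> ennreal (1 / 2)" by (rule ennreal_leI)
  then show ?thesis using \<open>0 < b\<close> assms by (simp add: divide_ennreal del: ennreal_half)
qed

lemma powr_le_if_hoelder:
  fixes x r K q :: real
  assumes "0 \<le> x" "0 \<le> K" "0 \<le> r" "0 < q" "x \<le> K * r powr (1 / q)"
  shows "x powr q \<le> K powr q * r"
proof -
  have "x powr q \<le> (K * r powr (1 / q)) powr q" using assms by (intro powr_mono2) auto
  also have "\<dots> = K powr q * r" using assms by (simp add: powr_mult powr_powr)
  finally show ?thesis .
qed

context area_regular_path
begin

lemma discretized_uniform_bound:
  "\<exists>K\<ge>0. \<forall>N>0. \<forall>t\<in>{0..T}. dist (discretized T N (grid T N) X t) (X t) \<le> K * (T / real N) powr (1 / p)"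
proof -
  obtain K where K: "0 \<le> K" "\<And>s t. 0 \<le> s \<Longrightarrow> s \<le> t \<Longrightarrow> t \<le> T \<Longrightarrow> norm (X t - X s) \<le> K * (t - s) powr (1 / p)"
    using hoelder by auto
  have cell: "dist (discretized T N (grid T N) X t) (X t) \<le> K * (T / real N) powr (1 / p)"
    if k: "k < N" "grid T N k \<le> t" "t < grid T N (Suc k)" for N k t
  proof -
    have "0 \<le> grid T N k" "t \<le> T" using k T grid_in[of T k N] grid_in[of T "Suc k" N] by auto
    then have "norm (X t - X (grid T N k)) \<le> K * (t - grid T N k) powr (1 / p)" using k by (intro K)
    also have "\<dots> \<le> K * (grid T N (Suc k) - grid T N k) powr (1 / p)"
      using k p K by (intro mult_left_mono powr_mono2) auto
    also have "grid T N (Suc k) - grid T N k = T / N" by (simp add: grid_diff)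
    finally show ?thesis
      using discretized_grid_cell[OF T k, of X] by (simp add: dist_norm norm_minus_commute)
  qed
  have "dist (discretized T N (grid T N) X t) (X t) \<le> K * (T / real N) powr (1 / p)"
    if N: "0 < N" and t: "t \<in> {0..T}" for N t
  proof (cases "t = T")
    case True
    then show ?thesis using K(1) T by (simp add: discretized_grid_last)
  next
    case False
    obtain k where k: "k < N" "grid T N k \<le> t" "t \<le> grid T N (Suc k)"
      using grid_cell[OF T N t] by blast
    show ?thesis
    proof (cases "t = grid T N (Suc k)")
      case True
      then have "Suc k < N" using False N k(1) grid_last[of N T] by (cases "Suc k = N") auto
      moreover have "t < grid T N (Suc (Suc k))"
        using True T N by (simp add: grid_def divide_strict_right_mono)
      ultimately show ?thesis using cell[of "Suc k" N t] True by simp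
    qed (use cell[of k N t] k in simp)
  qed
  with K(1) show ?thesis by blast
qed

lemma property_RIE_uniform_partitions:
  assumes part: "\<And>n. is_partition T (N n) (\<tau> n)"
    and unif: "\<And>n i. i < N n \<Longrightarrow> \<tau> n (Suc i) - \<tau> n i = h n"
    and h: "h \<longlonglongrightarrow> 0"
  shows "property_RIE T p N \<tau> X"
proof -
  have \<tau>0: "\<tau> n 0 = 0" "\<tau> n (N n) = T" for n using part[of n] by (auto simp: is_partition_def)
  have N: "0 < N n" for n using \<tau>0[of n] T by (cases "N n") auto
  have \<tau>h: "\<tau> n k = real k * h n" if "k \<le> N n" for n k
    using that
  proof (induction k)
    case (Suc k)
    then show ?case using unif[of k n] by (simp add: algebra_simps)
  qed (simp add: \<tau>0)
  have hT: "h n = T / real (N n)" for n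
    using \<tau>h[of "N n" n] N[of n] by (simp add: \<tau>0 field_simps)
  have \<tau>_grid: "\<tau> n k = grid T (N n) k" if "k \<le> N n" for n k
    using \<tau>h[OF that] by (simp add: hT grid_def)
  have RS: "riemann_sum (N n) (\<tau> n) X = R (N n)" for n
    by (rule riemann_sum_cong) (rule \<tau>_grid)
  have disc: "discretized T (N n) (\<tau> n) X = discretized T (N n) (grid T (N n)) X" for n
    by (rule discretized_cong) (rule \<tau>_grid)
  have "mesh (N n) (\<tau> n) = h n" for n
  proof -
    have "(\<lambda>i. \<bar>\<tau> n (Suc i) - \<tau> n i\<bar>) ` {..<N n} = {h n}"
      using unif[of _ n] N[of n] hT[of n] T by (auto simp: image_iff)
    then show ?thesis by (simp add: mesh_def)
  qed
  then have mesh: "(\<lambda>n. mesh (N n) (\<tau> n)) \<longlonglongrightarrow> 0" using h by simp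
  have N_lim: "filterlim N at_top sequentially"
    unfolding filterlim_at_top
  proof
    fix Z :: nat
    have "\<forall>\<^sub>F n in sequentially. h n < T / real (Suc Z)"
      using T by (intro order_tendstoD(2)[OF h]) simp
    then show "\<forall>\<^sub>F n in sequentially. Z \<le> N n"
    proof eventually_elim
      case (elim n)
      then have "\<not> real (N n) \<le> real (Suc Z)"
        using divide_left_mono[of "real (N n)" "real (Suc Z)" T] N[of n] T unfolding hT by auto
      then show ?case by simp
    qed
  qed
  obtain Kd where Kd: "\<forall>N>0. \<forall>t\<in>{0..T}.
      dist (discretized T N (grid T N) X t) (X t) \<le> Kd * (T / real N) powr (1 / p)"
    using discretized_uniform_bound by blast
  have unif_disc: "uniform_limit {0..T} (\<lambda>n. discretized T (N n) (\<tau> n) X) X sequentially"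
  proof (rule uniform_limit_if_bounded)
    show "dist (discretized T (N n) (\<tau> n) X t) (X t) \<le> Kd * h n powr (1 / p)" if "t \<in> {0..T}" for n t
      unfolding disc hT using Kd N that by blast
    have "(\<lambda>n. h n powr (1 / p)) \<longlonglongrightarrow> 0 powr (1 / p)"
      using p T by (intro tendsto_powr' h tendsto_const) (auto simp: hT)
    then have "(\<lambda>n. h n powr (1 / p)) \<longlonglongrightarrow> 0" by simp
    then show "(\<lambda>n. Kd * h n powr (1 / p)) \<longlonglongrightarrow> 0" by (rule tendsto_mult_right_zero)
  qed
  obtain K1 where K1: "0 \<le> K1" "\<And>s t. 0 \<le> s \<Longrightarrow> s \<le> t \<Longrightarrow> t \<le> T \<Longrightarrow> norm (X t - X s) \<le> K1 * (t - s) powr (1 / p)"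
    using hoelder by auto
  show ?thesis
  proof (rule riemann_sums_grid)
    fix J e K2
    assume K2: "0 \<le> K2" and e: "e \<longlonglongrightarrow> 0"
      and J: "\<And>N t. 0 < N \<Longrightarrow> t \<in> {0..T} \<Longrightarrow> norm (R N t - J t) \<le> e N"
      and A: "\<And>N k l. k < l \<Longrightarrow> l \<le> N \<Longrightarrow>
           norm (R N (grid T N l) - R N (grid T N k) - X (grid T N k) \<otimes>\<^sub>v (X (grid T N l) - X (grid T N k)))
             \<le> K2 * (grid T N l - grid T N k) powr (2 / p)"
    have "uniform_limit {0..T} (\<lambda>n. riemann_sum (N n) (\<tau> n) X) J sequentially"
      unfolding RS
      by (rule uniform_limit_if_bounded[where b = "\<lambda>n. e (N n)"])
        (use J N filterlim_compose[OF e N_lim] in \<open>auto simp: dist_norm\<close>)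
    then have unif_RS: "uniformly_convergent_on {0..T} (\<lambda>n. riemann_sum (N n) (\<tau> n) X)"
      by (auto simp: uniformly_convergent_on_def)
    define L where "L = K1 powr p + K2 powr (p / 2)"
    define w where "w s t = 2 * (L * (t - s))" for s t
    have L: "0 \<le> L" "K1 powr p \<le> L" "K2 powr (p / 2) \<le> L" by (auto simp: L_def)
    have ctrl: "control T w"
      unfolding control_def time_simplex_def w_def using L(1) by (auto simp: algebra_simps mult_right_mono)
    have level1: "(SUP (s, t)\<in>time_simplex T. ennreal (norm (X t - X s) powr p) / ennreal (w s t)) \<le> ennreal (1 / 2)"
    proof (rule SUP_least, split prod.split, intro allI impI)
      fix x s t assume "x \<in> time_simplex T" "x = (s, t)"
      then have st: "0 \<le> s" "s \<le> t" "t \<le> T" by (auto simp: time_simplex_def)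
      have "norm (X t - X s) powr p \<le> K1 powr p * (t - s)"
        using K1(1) st(2) p by (intro powr_le_if_hoelder K1(2)[OF st]) auto
      also have "\<dots> \<le> L * (t - s)" using st L by (intro mult_right_mono) auto
      finally show "ennreal (norm (X t - X s) powr p) / ennreal (w s t) \<le> ennreal (1 / 2)"
        by (intro ennreal_quotient_le_half) (simp_all add: w_def)
    qed
    have level2: "(SUP n. SUP (k, l)\<in>{(k, l). k < l \<and> l \<le> N n}.
           ennreal (norm (riemann_sum (N n) (\<tau> n) X (\<tau> n l) - riemann_sum (N n) (\<tau> n) X (\<tau> n k)
                          - X (\<tau> n k) \<otimes>\<^sub>v (X (\<tau> n l) - X (\<tau> n k))) powr (p / 2))
           / ennreal (w (\<tau> n k) (\<tau> n l))) \<le> ennreal (1 / 2)"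
    proof (rule SUP_least, rule SUP_least, split prod.split, intro allI impI)
      fix n x k l assume "x \<in> {(k, l). k < l \<and> l \<le> N n}" "x = (k, l)"
      then have kl: "k < l" "l \<le> N n" by auto
      let ?s = "grid T (N n) k" and ?t = "grid T (N n) l"
      have st: "?s \<le> ?t" using kl T by (intro grid_mono) auto
      have \<tau>: "\<tau> n k = ?s" "\<tau> n l = ?t" using kl \<tau>_grid[of k n] \<tau>_grid[of l n] by simp_all
      have "norm (R (N n) ?t - R (N n) ?s - X ?s \<otimes>\<^sub>v (X ?t - X ?s)) \<le> K2 * (?t - ?s) powr (1 / (p / 2))"
        using A[OF kl] by simp
      then have "norm (R (N n) ?t - R (N n) ?s - X ?s \<otimes>\<^sub>v (X ?t - X ?s)) powr (p / 2) \<le> K2 powr (p / 2) * (?t - ?s)"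
        using K2 st p by (intro powr_le_if_hoelder) simp_all
      also have "\<dots> \<le> L * (?t - ?s)" using st L by (intro mult_right_mono) simp_all
      finally show "ennreal (norm (riemann_sum (N n) (\<tau> n) X (\<tau> n l) - riemann_sum (N n) (\<tau> n) X (\<tau> n k)
                          - X (\<tau> n k) \<otimes>\<^sub>v (X (\<tau> n l) - X (\<tau> n k))) powr (p / 2))
           / ennreal (w (\<tau> n k) (\<tau> n l)) \<le> ennreal (1 / 2)"
        unfolding RS \<tau> by (intro ennreal_quotient_le_half) (simp_all add: w_def)
    qed
    have "ennreal (1 / 2) + ennreal (1 / 2) = 1"
      by (subst ennreal_plus[symmetric]) simp_all
    note level12 = add_mono[OF level1 level2, unfolded this]
    from ctrl level12 have "\<exists>w. control T w \<and>
        (SUP (s, t)\<in>time_simplex T. ennreal (norm (X t - X s) powr p) / ennreal (w s t)) +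
        (SUP n. SUP (k, l)\<in>{(k, l). k < l \<and> l \<le> N n}.
           ennreal (norm (riemann_sum (N n) (\<tau> n) X (\<tau> n l) - riemann_sum (N n) (\<tau> n) X (\<tau> n k)
                          - X (\<tau> n k) \<otimes>\<^sub>v (X (\<tau> n l) - X (\<tau> n k))) powr (p / 2))
           / ennreal (w (\<tau> n k) (\<tau> n l))) \<le> 1"
      by (rule exI[of _ w, OF conjI])
    with p part mesh cadlag_if_continuous_on[OF cont] unif_disc unif_RS show ?thesis
      unfolding property_RIE_def by simp
  qed
qed

end

section \<open>Moments of sums with Gaussian innovations\<close>

lemma centred_normal_moments:
  fixes \<xi> :: "'a \<Rightarrow> real"
  assumes nor: "distributed M lborel \<xi> (normal_density 0 (sqrt h))" and h: "0 < h"
  shows "integrable M (\<lambda>\<omega>. \<xi> \<omega> ^ n)"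
    and "(\<integral>\<omega>. \<xi> \<omega> ^ (2 * k) \<partial>M) = fact (2 * k) / (2 ^ k * fact k) * h ^ k"
    and "odd n \<Longrightarrow> (\<integral>\<omega>. \<xi> \<omega> ^ n \<partial>M) = 0"
proof -
  have s: "0 < sqrt h" using h by simp
  have tr: "(\<integral>\<omega>. \<xi> \<omega> ^ n \<partial>M) = (\<integral>x. normal_density 0 (sqrt h) x * (x - 0) ^ n \<partial>lborel)" for n
    using distributed_integral[OF nor, of "\<lambda>x. x ^ n"] by simp
  show "integrable M (\<lambda>\<omega>. \<xi> \<omega> ^ n)"
    using distributed_integrable[OF nor, of "\<lambda>x. x ^ n"] integrable_normal_moment[OF s, of 0 n]
    by simp
  show "(\<integral>\<omega>. \<xi> \<omega> ^ (2 * k) \<partial>M) = fact (2 * k) / (2 ^ k * fact k) * h ^ k"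
    unfolding tr integral_normal_moment_even[OF s] using h by (simp add: power_divide)
  show "odd n \<Longrightarrow> (\<integral>\<omega>. \<xi> \<omega> ^ n \<partial>M) = 0"
    unfolding tr using integral_normal_moment_odd[OF s, of 0] by (auto elim!: oddE)
qed

text \<open>
  The coefficients that appear in the expansion of the \<open>2q\<close>-th moment of \<open>D + v \<xi>\<close>, with \<open>\<xi>\<close> normal,
  are dominated by those of a \<open>q\<close>-th power; the quotient of consecutive terms in \<open>k\<close> is
  \<open>(q - k) (2q - 2k - 1) / (k + 1)\<close> on the left and \<open>(q - k) 2q / (k + 1)\<close> on the right.
\<close>

lemma choose_fact_le:
  assumes "k \<le> q"
  shows "real ((2 * q) choose (2 * k)) * (fact (2 * k) / (2 ^ k * fact k)) \<le> real (q choose k) * real (2 * q) ^ k"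
  using assms
proof (induction k)
  case (Suc k)
  have k: "k < q" using Suc.prems by simp
  have A: "real ((2 * q) choose (2 * Suc k)) * (fact (2 * Suc k) / (2 ^ Suc k * fact (Suc k)))
    = real ((2 * q) choose (2 * k)) * (fact (2 * k) / (2 ^ k * fact k))
      * (real (q - k) * real (2 * q - 2 * k - 1) / real (Suc k))"
  proof -
    have "2 * Suc k \<le> 2 * q" "2 * k \<le> 2 * q" using k by auto
    note b = this[THEN binomial_fact[where 'a=real]]
    have e: "2 * q - 2 * k = Suc (Suc (2 * q - 2 * Suc k))" using k by auto
    have f: "fact (2 * q - 2 * k) = real (2 * q - 2 * k) * real (2 * q - 2 * k - 1) * fact (2 * q - 2 * Suc k)"
      unfolding e by simp
    have g: "real (2 * q - 2 * k) = 2 * real (q - k)" using k by simp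
    have nz: "real (2 * q - 2 * k - 1) \<noteq> 0" "real (q - k) \<noteq> 0" using k by auto
    have "real ((2 * q) choose (2 * Suc k)) * (fact (2 * Suc k) / (2 ^ Suc k * fact (Suc k)))
       = fact (2 * q) / fact (2 * q - 2 * Suc k) / (2 ^ Suc k * fact (Suc k))"
      unfolding b by simp
    moreover have "real ((2 * q) choose (2 * k)) * (fact (2 * k) / (2 ^ k * fact k))
       = fact (2 * q) / fact (2 * q - 2 * k) / (2 ^ k * fact k)"
      unfolding b by simp
    moreover have "F / c / (2 * P * (s * K)) = F / (2 * a * b * c) / (P * K) * (a * b / s)"
      if "a \<noteq> 0" "b \<noteq> 0" for F P K a b c s :: real
      using that by (simp add: divide_simps)
    note this[OF nz(2,1), of "fact (2 * q)" "fact (2 * q - 2 * Suc k)" "2 ^ k" "real (Suc k)" "fact k"]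
    ultimately show ?thesis unfolding f g by (simp only: power_Suc fact_Suc)
  qed
  have B: "real (q choose Suc k) = real (q choose k) * (real (q - k) / real (Suc k))"
  proof -
    have "Suc k * (q choose Suc k) = (q choose k) * (q - k)"
      by (metis binomial_absorb_comp binomial_absorption mult.commute)
    then have "real (Suc k) * real (q choose Suc k) = real (q choose k) * real (q - k)"
      by (metis of_nat_mult)
    then show ?thesis by (simp add: divide_simps mult.commute)
  qed
  have "real ((2 * q) choose (2 * k)) * (fact (2 * k) / (2 ^ k * fact k))
      * (real (q - k) * real (2 * q - 2 * k - 1) / real (Suc k))
    \<le> real (q choose k) * real (2 * q) ^ k * (real (q - k) * real (2 * q) / real (Suc k))"
    by (rule mult_mono[OF Suc.IH[OF less_imp_le[OF k]] divide_right_mono[OF mult_left_mono]]) auto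
  also have "\<dots> = real (q choose Suc k) * real (2 * q) ^ Suc k" unfolding B by simp
  finally show ?case unfolding A .
qed simp

lemma power_mix_le_add:
  fixes a b :: real
  assumes "0 \<le> a" "0 \<le> b" "k \<le> n"
  shows "a ^ k * b ^ (n - k) \<le> a ^ n + b ^ n"
proof -
  have "a ^ k * b ^ (n - k) \<le> max a b ^ k * max a b ^ (n - k)"
    using assms by (intro mult_mono power_mono) auto
  also have "\<dots> = max a b ^ n" using assms(3) by (simp flip: power_add)
  also have "\<dots> \<le> a ^ n + b ^ n" using assms(1,2) by (auto simp: max_def)
  finally show ?thesis .
qed

lemma Int_stable_vimages: "Int_stable {X -` A \<inter> \<Omega> | A. A \<in> sets S}"
proof (rule Int_stableI)
  fix a b assume "a \<in> {X -` A \<inter> \<Omega> | A. A \<in> sets S}" "b \<in> {X -` A \<inter> \<Omega> | A. A \<in> sets S}"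
  then obtain A B where "A \<in> sets S" "B \<in> sets S" "a \<inter> b = X -` (A \<inter> B) \<inter> \<Omega>" by auto
  then show "a \<inter> b \<in> {X -` A \<inter> \<Omega> | A. A \<in> sets S}" by blast
qed

text \<open>
  Independence of a sub-sigma-algebra and a random variable, in the form in which it factorizes expectations.
\<close>

lemma (in prob_space) indep_var_compose_subalgebra:
  fixes X :: "'a \<Rightarrow> 'b" and Z :: "'a \<Rightarrow> 'c"
  assumes G: "subalgebra M G" and X: "X \<in> measurable G S"
    and Z: "Z \<in> measurable M K" and f: "f \<in> measurable K S'"
    and ind: "indep_set (sets G) {Z -` A \<inter> space M | A. A \<in> sets K}"
  shows "indep_var S X S' (\<lambda>\<omega>. f (Z \<omega>))"
proof -
  have "indep_set {X -` A \<inter> space M | A. A \<in> sets S} {(\<lambda>\<omega>. f (Z \<omega>)) -` A \<inter> space M | A. A \<in> sets S'}"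
    unfolding indep_set_def
  proof (rule indep_sets_mono_sets[OF ind[unfolded indep_set_def]])
    have "{X -` A \<inter> space M | A. A \<in> sets S} \<subseteq> sets G"
      using measurable_sets[OF X] G by (auto simp: subalgebra_def)
    moreover have "{(\<lambda>\<omega>. f (Z \<omega>)) -` A \<inter> space M | A. A \<in> sets S'} \<subseteq> {Z -` A \<inter> space M | A. A \<in> sets K}"
    proof safe
      fix A assume "A \<in> sets S'"
      then have "f -` A \<inter> space K \<in> sets K" using f by (rule measurable_sets[rotated])
      moreover have "(\<lambda>\<omega>. f (Z \<omega>)) -` A \<inter> space M = Z -` (f -` A \<inter> space K) \<inter> space M"
        using measurable_space[OF Z] by auto
      ultimately show "\<exists>B. (\<lambda>\<omega>. f (Z \<omega>)) -` A \<inter> space M = Z -` B \<inter> space M \<and> B \<in> sets K"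
        by blast
    qed
    ultimately show "case_bool {X -` A \<inter> space M | A. A \<in> sets S} {(\<lambda>\<omega>. f (Z \<omega>)) -` A \<inter> space M | A. A \<in> sets S'} b
      \<subseteq> case_bool (sets G) {Z -` A \<inter> space M | A. A \<in> sets K} b" for b
      by (cases b) auto
  qed
  then have "indep_set (sigma_sets (space M) {X -` A \<inter> space M | A. A \<in> sets S})
       (sigma_sets (space M) {(\<lambda>\<omega>. f (Z \<omega>)) -` A \<inter> space M | A. A \<in> sets S'})"
    by (rule indep_set_sigma_sets) (rule Int_stable_vimages)+
  then show ?thesis
    unfolding indep_var_eq using measurable_from_subalg[OF G X] Z f by auto
qed

text \<open>
  One step of a Burkholder inequality in \<open>L\<^sup>2\<^sup>q\<close>: adding \<open>v \<xi>\<close> with an independent \<open>\<xi> \<sim> N(0,h)\<close> increases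
  the bound \<open>x\<close> on the squared norm of \<open>D\<close> only by a multiple of \<open>V h\<close>, without a cross term,
  since odd moments of \<open>\<xi>\<close> vanish.  The bounds have the form \<open>x\<^sup>q\<close> so that they can be iterated.
\<close>

lemma (in prob_space) moment_add_indep_normal:
  fixes D v :: "'a \<Rightarrow> real" and Z :: "'a \<Rightarrow> 'b"
  assumes G: "subalgebra M G" and D_G: "D \<in> borel_measurable G" and v_G: "v \<in> borel_measurable G"
    and Z: "Z \<in> measurable M K" and ind: "indep_set (sets G) {Z -` A \<inter> space M | A. A \<in> sets K}"
    and f: "f \<in> borel_measurable K" and \<xi>: "\<And>\<omega>. \<xi> \<omega> = f (Z \<omega>)"
    and h: "0 < h" and nor: "distributed M lborel \<xi> (normal_density 0 (sqrt h))"
    and iD: "integrable M (\<lambda>\<omega>. D \<omega> ^ (2 * q))" and iv: "integrable M (\<lambda>\<omega>. v \<omega> ^ (2 * q))"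
    and D: "expectation (\<lambda>\<omega>. D \<omega> ^ (2 * q)) \<le> x ^ q"
    and v: "expectation (\<lambda>\<omega>. v \<omega> ^ (2 * q)) \<le> V ^ q"
    and x: "0 < x" and V: "0 < V"
  shows "integrable M (\<lambda>\<omega>. (D \<omega> + v \<omega> * \<xi> \<omega>) ^ (2 * q))"
    and "expectation (\<lambda>\<omega>. (D \<omega> + v \<omega> * \<xi> \<omega>) ^ (2 * q)) \<le> (x + 4 * real q * V * h) ^ q"
proof -
  define P where "P k \<omega> = v \<omega> ^ k * D \<omega> ^ (2 * q - k)" for k \<omega>
  note [measurable] = measurable_from_subalg[OF G D_G] measurable_from_subalg[OF G v_G]
  have iP: "integrable M (P k)" if "k \<le> 2 * q" for k
  proof (rule Bochner_Integration.integrable_bound[OF Bochner_Integration.integrable_add[OF iv iD]])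
    show "P k \<in> borel_measurable M" unfolding P_def by measurable
    have "\<bar>P k \<omega>\<bar> \<le> v \<omega> ^ (2 * q) + D \<omega> ^ (2 * q)" for \<omega>
      using power_mix_le_add[of "\<bar>v \<omega>\<bar>" "\<bar>D \<omega>\<bar>" k "2 * q"] that
      by (simp add: P_def abs_mult power_abs power_even_abs)
    then show "AE \<omega> in M. norm (P k \<omega>) \<le> norm (v \<omega> ^ (2 * q) + D \<omega> ^ (2 * q))"
      by (intro always_eventually allI) (smt (verit, best) real_norm_def)
  qed
  have indP: "indep_var borel (P k) borel (\<lambda>\<omega>. \<xi> \<omega> ^ k)" for k
  proof -
    have "P k \<in> borel_measurable G" unfolding P_def[abs_def] using D_G v_G by measurable
    moreover have "(\<lambda>z. f z ^ k) \<in> borel_measurable K" using f by measurable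
    ultimately show ?thesis
      unfolding \<xi> by (rule indep_var_compose_subalgebra[OF G _ Z _ ind])
  qed
  note i\<xi> = centred_normal_moments(1)[OF nor h]
  have iP\<xi>: "integrable M (\<lambda>\<omega>. P k \<omega> * \<xi> \<omega> ^ k)" if "k \<le> 2 * q" for k
    by (rule indep_var_integrable[OF indP iP[OF that] i\<xi>])
  have expand: "(D \<omega> + v \<omega> * \<xi> \<omega>) ^ (2 * q)
      = (\<Sum>k\<le>2 * q. real ((2 * q) choose k) * (P k \<omega> * \<xi> \<omega> ^ k))" for \<omega>
    unfolding add.commute[of "D \<omega>"] binomial_ring P_def
    by (intro sum.cong) (auto simp: power_mult_distrib)
  show "integrable M (\<lambda>\<omega>. (D \<omega> + v \<omega> * \<xi> \<omega>) ^ (2 * q))"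
    unfolding expand using iP\<xi> by (intro Bochner_Integration.integrable_sum integrable_mult_right) auto
  have "expectation (\<lambda>\<omega>. (D \<omega> + v \<omega> * \<xi> \<omega>) ^ (2 * q))
      = (\<Sum>k\<le>2 * q. real ((2 * q) choose k) * expectation (\<lambda>\<omega>. P k \<omega> * \<xi> \<omega> ^ k))"
    unfolding expand using iP\<xi> by (subst Bochner_Integration.integral_sum) auto
  also have "\<dots> = (\<Sum>k\<le>2 * q. real ((2 * q) choose k) * (expectation (P k) * expectation (\<lambda>\<omega>. \<xi> \<omega> ^ k)))"
    using indep_var_lebesgue_integral[OF indP iP i\<xi>] by (intro sum.cong) auto
  also have "\<dots> = (\<Sum>k\<in>(*) 2 ` {..q}. real ((2 * q) choose k) * (expectation (P k) * expectation (\<lambda>\<omega>. \<xi> \<omega> ^ k)))"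
  proof (rule sum.mono_neutral_right)
    show "\<forall>k\<in>{..2 * q} - (*) 2 ` {..q}.
        real ((2 * q) choose k) * (expectation (P k) * expectation (\<lambda>\<omega>. \<xi> \<omega> ^ k)) = 0"
    proof
      fix k assume k: "k \<in> {..2 * q} - (*) 2 ` {..q}"
      have "odd k"
      proof
        assume "even k" then obtain j where "k = 2 * j" by (elim evenE)
        with k show False by auto
      qed
      then show "real ((2 * q) choose k) * (expectation (P k) * expectation (\<lambda>\<omega>. \<xi> \<omega> ^ k)) = 0"
        using centred_normal_moments(3)[OF nor h] by simp
    qed
  qed auto
  also have "\<dots> = (\<Sum>k\<le>q. real ((2 * q) choose (2 * k)) * (fact (2 * k) / (2 ^ k * fact k))
                         * (h ^ k * expectation (P (2 * k))))"
    unfolding sum.reindex[OF inj_onI[of "{..q}" "(*) 2", simplified]]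
    by (simp only: o_def centred_normal_moments(2)[OF nor h]) (simp add: mult_ac)
  also have "\<dots> \<le> (\<Sum>k\<le>q. real (q choose k) * (4 * real q * V * h) ^ k * x ^ (q - k))"
  proof (rule sum_mono)
    fix k assume "k \<in> {..q}" then have k: "k \<le> q" by simp
    have EP: "expectation (P (2 * k)) \<le> 2 ^ k * V ^ k * x ^ (q - k)"
    proof (cases "k = 0")
      case True
      then show ?thesis using D by (simp add: P_def[abs_def])
    next
      case False
      \<comment> \<open>a crude form of Young's inequality, after normalizing both factors; the resulting factor 2
        is absorbed by \<open>2\<^sup>k\<close> as \<open>k > 0\<close>\<close>
      have pw: "P (2 * k) \<omega> \<le> V ^ k * x ^ (q - k) * (v \<omega> ^ (2 * q) / V ^ q + D \<omega> ^ (2 * q) / x ^ q)" for \<omega>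
      proof -
        have "P (2 * k) \<omega> = V ^ k * x ^ (q - k) * (((v \<omega>)\<^sup>2 / V) ^ k * ((D \<omega>)\<^sup>2 / x) ^ (q - k))"
          using V x by (simp add: P_def power_divide power_mult diff_mult_distrib2[symmetric])
        also have "\<dots> \<le> V ^ k * x ^ (q - k) * (((v \<omega>)\<^sup>2 / V) ^ q + ((D \<omega>)\<^sup>2 / x) ^ q)"
          using V x by (intro mult_left_mono power_mix_le_add k) auto
        finally show ?thesis by (simp add: power_divide power_mult)
      qed
      have "expectation (P (2 * k))
          \<le> expectation (\<lambda>\<omega>. V ^ k * x ^ (q - k) * (v \<omega> ^ (2 * q) / V ^ q + D \<omega> ^ (2 * q) / x ^ q))"
        using iv iD iP[of "2 * k"] k pw by (intro integral_mono) auto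
      also have "\<dots> = V ^ k * x ^ (q - k) * (expectation (\<lambda>\<omega>. v \<omega> ^ (2 * q)) / V ^ q
                         + expectation (\<lambda>\<omega>. D \<omega> ^ (2 * q)) / x ^ q)"
        using iv iD by simp
      also have "\<dots> \<le> V ^ k * x ^ (q - k) * (1 + 1)"
        using v D V x by (intro mult_left_mono add_mono) auto
      also have "\<dots> \<le> V ^ k * x ^ (q - k) * 2 ^ k"
        using False V x self_le_power[of "2::real" k] by (intro mult_left_mono) auto
      finally show ?thesis by (simp add: mult_ac)
    qed
    have P0: "0 \<le> expectation (P (2 * k))"
      by (intro integral_nonneg_AE always_eventually) (auto simp: P_def diff_mult_distrib2[symmetric])
    have "real ((2 * q) choose (2 * k)) * (fact (2 * k) / (2 ^ k * fact k)) * (h ^ k * expectation (P (2 * k)))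
        \<le> real (q choose k) * real (2 * q) ^ k * (h ^ k * (2 ^ k * V ^ k * x ^ (q - k)))"
      using h EP P0 by (intro mult_mono choose_fact_le k) auto
    also have "\<dots> = real (q choose k) * ((real (2 * q) * h * 2 * V) ^ k) * x ^ (q - k)"
      by (simp only: power_mult_distrib mult_ac)
    also have "real (2 * q) * h * 2 * V = 4 * real q * V * h" by simp
    finally show "real ((2 * q) choose (2 * k)) * (fact (2 * k) / (2 ^ k * fact k)) * (h ^ k * expectation (P (2 * k)))
        \<le> real (q choose k) * (4 * real q * V * h) ^ k * x ^ (q - k)" .
  qed
  also have "\<dots> = (x + 4 * real q * V * h) ^ q"
    unfolding add.commute[of x] binomial_ring ..
  finally show "expectation (\<lambda>\<omega>. (D \<omega> + v \<omega> * \<xi> \<omega>) ^ (2 * q)) \<le> (x + 4 * real q * V * h) ^ q" .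
qed

text \<open>
  If the sum of all \<open>2q\<close>-th powers is integrable, then it is almost surely finite, and it
  dominates each single term.
\<close>

lemma (in prob_space) AE_bounded_if_summable_moments:
  fixes Y :: "nat \<Rightarrow> 'i \<Rightarrow> 'a \<Rightarrow> real"
  assumes fin: "\<And>n. finite (I n)"
    and int: "\<And>n i. i \<in> I n \<Longrightarrow> integrable M (\<lambda>\<omega>. Y n i \<omega> ^ (2 * q))"
    and bnd: "\<And>n i. i \<in> I n \<Longrightarrow> expectation (\<lambda>\<omega>. Y n i \<omega> ^ (2 * q)) \<le> b n"
    and sb: "summable (\<lambda>n. real (card (I n)) * b n)" and q: "0 < q"
  shows "AE \<omega> in M. \<exists>C. \<forall>n. \<forall>i\<in>I n. \<bar>Y n i \<omega>\<bar> \<le> C"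
proof -
  define S where "S n \<omega> = (\<Sum>i\<in>I n. Y n i \<omega> ^ (2 * q))" for n \<omega>
  have S0: "0 \<le> S n \<omega>" for n \<omega> by (auto simp: S_def intro!: sum_nonneg)
  have iS: "integrable M (S n)" for n unfolding S_def using int by auto
  note [measurable] = borel_measurable_integrable[OF iS]
  have ES: "expectation (S n) \<le> real (card (I n)) * b n" for n
  proof -
    have "expectation (S n) = (\<Sum>i\<in>I n. expectation (\<lambda>\<omega>. Y n i \<omega> ^ (2 * q)))"
      unfolding S_def using int by (subst Bochner_Integration.integral_sum) auto
    also have "\<dots> \<le> (\<Sum>i\<in>I n. b n)" by (intro sum_mono bnd)
    finally show ?thesis by simp
  qed
  have ES0: "0 \<le> expectation (S n)" for n
    using S0 by (intro integral_nonneg_AE) auto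
  have "(\<integral>\<^sup>+\<omega>. (\<Sum>n. ennreal (S n \<omega>)) \<partial>M) = (\<Sum>n. \<integral>\<^sup>+\<omega>. ennreal (S n \<omega>) \<partial>M)"
    by (rule nn_integral_suminf) measurable
  also have "\<dots> = (\<Sum>n. ennreal (expectation (S n)))"
    using iS S0 by (intro suminf_cong nn_integral_eq_integral) auto
  also have "\<dots> = ennreal (\<Sum>n. expectation (S n))"
    using ES ES0 by (intro suminf_ennreal2 summable_comparison_test'[OF sb, of 0]) auto
  finally have "AE \<omega> in M. (\<Sum>n. ennreal (S n \<omega>)) \<noteq> \<infinity>"
    by (intro nn_integral_noteq_infinite) auto
  then show ?thesis
  proof eventually_elim
    case (elim \<omega>)
    define C where "C = enn2real (\<Sum>n. ennreal (S n \<omega>))"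
    have "\<bar>Y n i \<omega>\<bar> \<le> max 1 C" if i: "i \<in> I n" for n i
    proof -
      have "ennreal (S n \<omega>) \<le> (\<Sum>n. ennreal (S n \<omega>))"
        using sum_le_suminf[of "\<lambda>n. ennreal (S n \<omega>)" "{n}"] by auto
      also have "\<dots> = ennreal C" using elim by (simp add: C_def less_top)
      finally have "S n \<omega> \<le> C" by (simp add: C_def)
      moreover have "Y n i \<omega> ^ (2 * q) \<le> S n \<omega>"
        unfolding S_def using fin i by (intro member_le_sum) auto
      ultimately have le: "\<bar>Y n i \<omega>\<bar> ^ (2 * q) \<le> C" by (simp add: power_even_abs)
      show ?thesis
      proof (cases "\<bar>Y n i \<omega>\<bar> \<le> 1")
        case False
        then have "\<bar>Y n i \<omega>\<bar> \<le> \<bar>Y n i \<omega>\<bar> ^ (2 * q)" using q by (intro self_le_power) auto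
        with le show ?thesis by simp
      qed simp
    qed
    then show ?case by blast
  qed
qed

section \<open>Moment bounds for Brownian motion\<close>

lemma norm_matrix_le_l1: "norm (A :: real ^ 'm ^ 'n) \<le> (\<Sum>i\<in>UNIV. \<Sum>j\<in>UNIV. \<bar>A $ i $ j\<bar>)"
proof -
  have "norm A \<le> (\<Sum>i\<in>UNIV. norm (A $ i))" unfolding norm_vec_def by (rule L2_set_le_sum) simp
  also have "\<dots> \<le> (\<Sum>i\<in>UNIV. \<Sum>j\<in>UNIV. \<bar>A $ i $ j\<bar>)" by (intro sum_mono norm_le_l1_cart)
  finally show ?thesis .
qed

lemma vec_nth_measurable: "(\<lambda>x :: real ^ 'n. x $ i) \<in> borel_measurable borel"
  by (intro borel_measurable_continuous_onI continuous_intros)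

lemma grid_div:
  assumes "0 \<le> T" "0 < N" "0 < K"
  shows "grid T N (i div K) \<le> grid T (N * K) i" "grid T (N * K) i \<le> grid T N (i div K) + T / N"
proof -
  show "grid T N (i div K) \<le> grid T (N * K) i"
    unfolding grid_refine[OF assms(3), of T N, symmetric] using assms by (intro grid_mono) auto
  have "i \<le> Suc (i div K) * K" using dividend_less_div_times[OF assms(3), of i] by simp
  then have "grid T (N * K) i \<le> grid T N (Suc (i div K))"
    unfolding grid_refine[OF assms(3), of T N, symmetric] using assms by (intro grid_mono) auto
  also have "\<dots> = grid T N (i div K) + T / N"
    by (simp add: grid_def add_divide_distrib distrib_right)
  finally show "grid T (N * K) i \<le> grid T N (i div K) + T / N" .
qed

context brownian_motion
begin

text \<open>
  The \<open>2q\<close>-th moment of the standard normal distribution.  The maximum with 1 permits to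
  absorb it into a \<open>q\<close>-th power.
\<close>

definition moment_const :: "nat \<Rightarrow> real" where
  "moment_const q = max 1 (fact (2 * q) / (2 ^ q * fact q))"

lemma W_measurable [measurable]: "t \<in> {0..T} \<Longrightarrow> W t \<in> borel_measurable M"
  using measurable_from_subalg[OF subalgebra_F adapted] .

lemma W_measurable_F:
  assumes "0 \<le> s" "s \<le> t" "t \<le> T"
  shows "W s \<in> borel_measurable (F t)"
proof -
  have "subalgebra M (F s)" "subalgebra M (F t)" using assms by (auto intro: subalgebra_F)
  then have "subalgebra (F t) (F s)"
    using sets_F_mono[OF assms] by (auto simp: subalgebra_def)
  then show ?thesis by (rule measurable_from_subalg[OF _ adapted]) (use assms in auto)
qed

lemma increment_moment:
  assumes st: "s \<in> {0..T}" "t \<in> {0..T}" and q: "0 < q"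
  shows "integrable M (\<lambda>\<omega>. ((W t \<omega> - W s \<omega>) $ i) ^ (2 * q))"
    and "expectation (\<lambda>\<omega>. ((W t \<omega> - W s \<omega>) $ i) ^ (2 * q)) \<le> (moment_const q * \<bar>t - s\<bar>) ^ q"
proof -
  have ordered: "integrable M (\<lambda>\<omega>. ((W t \<omega> - W s \<omega>) $ i) ^ (2 * q)) \<and>
    expectation (\<lambda>\<omega>. ((W t \<omega> - W s \<omega>) $ i) ^ (2 * q)) \<le> (moment_const q * \<bar>t - s\<bar>) ^ q"
    if "0 \<le> s" "s < t" "t \<le> T" for s t
  proof -
    note nor = increment_components_normal[OF that, of i]
    have h: "0 < t - s" using that by simp
    have "fact (2 * q) / (2 ^ q * fact q) \<le> moment_const q" by (simp add: moment_const_def)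
    also have "\<dots> \<le> moment_const q ^ q" using q by (intro self_le_power) (auto simp: moment_const_def)
    finally have "fact (2 * q) / (2 ^ q * fact q) * (t - s) ^ q \<le> moment_const q ^ q * (t - s) ^ q"
      using h by (intro mult_right_mono) auto
    then show ?thesis
      using centred_normal_moments(1)[OF nor h, of "2 * q"] centred_normal_moments(2)[OF nor h, of q] h
      by (simp add: power_mult_distrib)
  qed
  have "integrable M (\<lambda>\<omega>. ((W t \<omega> - W s \<omega>) $ i) ^ (2 * q)) \<and>
    expectation (\<lambda>\<omega>. ((W t \<omega> - W s \<omega>) $ i) ^ (2 * q)) \<le> (moment_const q * \<bar>t - s\<bar>) ^ q"
  proof (cases s t rule: linorder_cases)
    case less
    then show ?thesis using st ordered[of s t] by auto
  next
    case equal
    then show ?thesis using q by (simp add: power_0_left)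
  next
    case greater
    have "((W t \<omega> - W s \<omega>) $ i) ^ (2 * q) = ((W s \<omega> - W t \<omega>) $ i) ^ (2 * q)" for \<omega>
      by (simp add: power_mult power2_commute)
    then show ?thesis using st greater ordered[of t s] by (simp add: abs_minus_commute)
  qed
  then show "integrable M (\<lambda>\<omega>. ((W t \<omega> - W s \<omega>) $ i) ^ (2 * q))"
    and "expectation (\<lambda>\<omega>. ((W t \<omega> - W s \<omega>) $ i) ^ (2 * q)) \<le> (moment_const q * \<bar>t - s\<bar>) ^ q"
    by auto
qed

text \<open>
  The moment bound for discrete stochastic integrals against Brownian motion, by iterating
  \<open>moment_add_indep_normal\<close>.  The step estimate needs a positive bound to begin with although
  the empty sum is zero; \<open>\<delta>\<close> provides it.
\<close>

lemma transform_moment: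
  fixes v :: "nat \<Rightarrow> 'a \<Rightarrow> real"
  assumes h: "0 < h" and b: "real b * h \<le> T" and \<delta>: "0 < \<delta>" and V: "0 < V"
    and v: "\<And>i. i < b \<Longrightarrow> v i \<in> borel_measurable (F (real i * h))"
    and iv: "\<And>i. i < b \<Longrightarrow> integrable M (\<lambda>\<omega>. v i \<omega> ^ (2 * q))"
    and Ev: "\<And>i. i < b \<Longrightarrow> expectation (\<lambda>\<omega>. v i \<omega> ^ (2 * q)) \<le> V ^ q"
    and n: "a \<le> n" "n \<le> b"
  shows "integrable M (\<lambda>\<omega>. (\<Sum>i=a..<n. v i \<omega> * (W (real (Suc i) * h) \<omega> - W (real i * h) \<omega>) $ j) ^ (2 * q)) \<and>
    expectation (\<lambda>\<omega>. (\<Sum>i=a..<n. v i \<omega> * (W (real (Suc i) * h) \<omega> - W (real i * h) \<omega>) $ j) ^ (2 * q))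
      \<le> (\<delta> + 4 * real q * V * h * real (n - a)) ^ q"
  using n
proof (induction n rule: dec_induct)
  case base
  show ?case using \<delta> by (cases "q = 0") (auto simp: power_0_left prob_space)
next
  case (step n)
  let ?s = "\<lambda>i. real i * h"
  let ?D = "\<lambda>\<omega>. \<Sum>i=a..<n. v i \<omega> * (W (?s (Suc i)) \<omega> - W (?s i) \<omega>) $ j"
  let ?x = "\<delta> + 4 * real q * V * h * real (n - a)"
  have n: "n < b" using step by simp
  have s: "0 \<le> ?s i" "?s i \<le> ?s n" if "i \<le> n" for i using h that by auto
  have "real (Suc n) * h \<le> real b * h" using h n by (intro mult_right_mono) auto
  then have sS: "?s (Suc n) \<le> T" using b by simp
  have sn: "0 \<le> ?s n" "?s n < ?s (Suc n)" using h by (auto simp: algebra_simps)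
  have sub: "subalgebra M (F (?s n))" using sn sS by (intro subalgebra_F) auto
  have F_mono: "subalgebra (F (?s n)) (F (?s i))" if "i \<le> n" for i
  proof -
    have "?s i \<le> T" using s(2)[OF that] sn sS by simp
    then have "subalgebra M (F (?s i))" using s[OF that] by (intro subalgebra_F) auto
    then show ?thesis
      using sub sets_F_mono[of "?s i" "?s n"] s[OF that] sn sS by (auto simp: subalgebra_def)
  qed
  have D: "?D \<in> borel_measurable (F (?s n))"
  proof (intro borel_measurable_sum borel_measurable_times)
    fix i assume i: "i \<in> {a..<n}"
    show "v i \<in> borel_measurable (F (?s n))"
      using i n by (intro measurable_from_subalg[OF F_mono v]) auto
    have "W (?s (Suc i)) \<in> borel_measurable (F (?s n))" "W (?s i) \<in> borel_measurable (F (?s n))"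
      using i sn sS s[of i] s[of "Suc i"] by (auto intro!: W_measurable_F)
    then show "(\<lambda>\<omega>. (W (?s (Suc i)) \<omega> - W (?s i) \<omega>) $ j) \<in> borel_measurable (F (?s n))"
      by (intro measurable_compose[OF borel_measurable_diff[of "W (?s (Suc i))" _ "W (?s i)"] vec_nth_measurable])
  qed
  have Z: "(\<lambda>\<omega>. W (?s (Suc n)) \<omega> - W (?s n) \<omega>) \<in> borel_measurable M"
    using sn sS by (intro borel_measurable_diff W_measurable) auto
  have hh: "?s (Suc n) - ?s n = h" by (simp add: algebra_simps)
  have x: "0 < ?x" using \<delta> V h by (intro add_pos_nonneg) auto
  note IH = step.IH[OF less_imp_le[OF n]]
  have "real (Suc n - a) = real (n - a) + 1" using step.hyps by (simp add: Suc_diff_le)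
  then have eq: "\<delta> + 4 * real q * V * h * real (Suc n - a) = ?x + 4 * real q * V * h" by (simp add: algebra_simps)
  have sum: "(\<Sum>i=a..<Suc n. v i \<omega> * (W (?s (Suc i)) \<omega> - W (?s i) \<omega>) $ j)
      = ?D \<omega> + v n \<omega> * (W (?s (Suc n)) \<omega> - W (?s n) \<omega>) $ j" for \<omega>
    using step.hyps by simp
  note * = moment_add_indep_normal[OF sub D v[OF n] Z increment_indep[OF sn sS],
      of "\<lambda>x. x $ j" "\<lambda>\<omega>. (W (?s (Suc n)) \<omega> - W (?s n) \<omega>) $ j" h q ?x V]
  show ?case
    unfolding sum eq
    using increment_components_normal[OF sn sS, of j] h iv[OF n] Ev[OF n] IH x V unfolding hh
    by (intro conjI *) auto
qed

text \<open>
  The integrand is the increment of the path between the last points of the two grids up to a given time.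
  These lie within \<open>T/N\<close> of each other, so the integrand has variance at most \<open>T/N\<close>, and it is known at that time.
\<close>

lemma riemann_diff_moment:
  assumes T: "0 < T" and NK: "0 < N" "N \<le> K" and kl: "k < l" "l \<le> N" and q: "0 < q"
  defines "D \<equiv> \<lambda>\<omega>. riemann_diff T K N (\<lambda>t. W t \<omega>) (grid T N l) - riemann_diff T K N (\<lambda>t. W t \<omega>) (grid T N k)"
  shows "integrable M (\<lambda>\<omega>. (D \<omega> $ x $ y) ^ (2 * q))"
    and "expectation (\<lambda>\<omega>. (D \<omega> $ x $ y) ^ (2 * q))
      \<le> (8 * real q * moment_const q * T * ((grid T N l - grid T N k) / real N)) ^ q"
proof -
  have K: "0 < K" using NK by simp
  define h where "h = T / real (N * K)"
  have h: "0 < h" using T NK K by (simp add: h_def)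
  have gh: "grid T (N * K) i = real i * h" for i by (simp add: grid_def h_def)
  define u1 where "u1 i = grid T K (i div N)" for i
  define u2 where "u2 i = grid T N (i div K)" for i
  define v where "v i \<omega> = (W (u1 i) \<omega> - W (u2 i) \<omega>) $ x" for i \<omega>
  define V where "V = moment_const q * (T / real N)"
  have c: "1 \<le> moment_const q" by (simp add: moment_const_def)
  have V: "0 < V" using c T NK by (simp add: V_def)
  \<comment> \<open>the bound that \<open>transform_moment\<close> accumulates, so that \<open>\<delta>\<close> merely doubles it\<close>
  define \<delta> where "\<delta> = 4 * real q * V * h * real (l * K - k * K)"
  have \<delta>: "0 < \<delta>" using q V h kl K by (simp add: \<delta>_def)
  have lK: "l * K \<le> N * K" using kl by simp
  have lT: "real (l * K) * h \<le> T"
    using grid_in[OF less_imp_le[OF T] lK] by (simp add: gh)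
  have u: "0 \<le> u1 i" "u1 i \<le> real i * h" "0 \<le> u2 i" "u2 i \<le> real i * h" "\<bar>u1 i - u2 i\<bar> \<le> T / real N" for i
  proof -
    have "T / real K \<le> T / real N" using T NK by (intro divide_left_mono) auto
    moreover note grid_div[of T N K i] grid_div[of T K N i]
    ultimately have "u1 i \<le> real i * h" "u2 i \<le> real i * h"
      "real i * h \<le> u1 i + T / real N" "real i * h \<le> u2 i + T / real N"
      using T NK K unfolding u1_def u2_def gh[symmetric] mult.commute[of K N] by auto
    then show "u1 i \<le> real i * h" "u2 i \<le> real i * h" "\<bar>u1 i - u2 i\<bar> \<le> T / real N" by auto
    show "0 \<le> u1 i" "0 \<le> u2 i" using T by (auto simp: u1_def u2_def grid_def)
  qed
  have iT: "real i * h \<le> T" if "i < l * K" for i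
  proof -
    have "real i * h \<le> real (l * K) * h" using that h by (intro mult_right_mono of_nat_mono) auto
    with lT show ?thesis by simp
  qed
  have uT: "u1 i \<in> {0..T}" "u2 i \<in> {0..T}" if "i < l * K" for i
    using u(1-4)[of i] iT[OF that] by auto
  have v: "v i \<in> borel_measurable (F (real i * h))" if "i < l * K" for i
    unfolding v_def
    by (intro measurable_compose[OF borel_measurable_diff vec_nth_measurable] W_measurable_F u iT[OF that])
  have vm: "integrable M (\<lambda>\<omega>. v i \<omega> ^ (2 * q))" "expectation (\<lambda>\<omega>. v i \<omega> ^ (2 * q)) \<le> V ^ q" if "i < l * K" for i
  proof -
    note m = increment_moment[OF uT(2,1)[OF that] q, of x]
    show "integrable M (\<lambda>\<omega>. v i \<omega> ^ (2 * q))" unfolding v_def by (rule m(1))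
    have "(moment_const q * \<bar>u1 i - u2 i\<bar>) ^ q \<le> V ^ q"
      unfolding V_def using c u(5)[of i] by (intro power_mono mult_left_mono) auto
    with m(2) show "expectation (\<lambda>\<omega>. v i \<omega> ^ (2 * q)) \<le> V ^ q" unfolding v_def by (rule order.trans)
  qed
  have D: "D \<omega> $ x $ y = (\<Sum>i=k * K..<l * K. v i \<omega> * (W (real (Suc i) * h) \<omega> - W (real i * h) \<omega>) $ y)" for \<omega>
    unfolding D_def riemann_diff_common_refinement[OF less_imp_le[OF T] NK(1) K less_imp_le[OF kl(1)] kl(2)]
    by (simp only: sum_component tensor_def vec_lambda_beta v_def u1_def u2_def gh)
  have "k * K \<le> l * K" using kl by simp
  note tm = transform_moment[OF h lT \<delta> V v vm this order_refl, of y]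
  from tm show "integrable M (\<lambda>\<omega>. (D \<omega> $ x $ y) ^ (2 * q))" unfolding D by blast
  have "\<delta> + 4 * real q * V * h * real (l * K - k * K) = 8 * real q * V * (h * real (l * K - k * K))"
    by (simp add: \<delta>_def)
  also have "h * real (l * K - k * K) = grid T N l - grid T N k"
    using grid_diff[of "k * K" "l * K" T "N * K"] kl
    unfolding grid_refine[OF K] h_def by (simp add: mult.commute)
  finally show "expectation (\<lambda>\<omega>. (D \<omega> $ x $ y) ^ (2 * q))
      \<le> (8 * real q * moment_const q * T * ((grid T N l - grid T N k) / real N)) ^ q"
    using tm unfolding D V_def by (simp add: mult_ac)
qed

end

section \<open>Almost sure bounds for Brownian paths\<close>

lemma sqrt_power_double: "0 \<le> r \<Longrightarrow> sqrt r ^ (2 * q) = r ^ q"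
  by (simp add: power_mult)

lemma AE_UNIV_finite: "(\<And>i :: 'i :: finite. AE \<omega> in M. P i \<omega>) \<Longrightarrow> AE \<omega> in M. \<forall>i. P i \<omega>"
  using AE_finite_allI[where S = "UNIV :: 'i set" and M = M and Q = P] by simp

context brownian_motion
begin

text \<open>
  After division by \<open>N\<^sup>-\<^sup>\<epsilon> (t - s)\<^sup>1\<^sup>/\<^sup>2\<close> the bound on the \<open>2q\<close>-th moment no longer depends on \<open>s\<close> and \<open>t\<close>
  and decays like \<open>N\<close> to the power \<open>-q (2 - 4/p)\<close>.  Since there are at most \<open>N\<^sup>2\<close> pairs of
  grid points, \<open>q (2 - 4/p) \<ge> 4\<close> makes the sum over all \<open>N\<close> and all pairs finite.
\<close>

lemma AE_riemann_diff_component_bound: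
  assumes T: "0 < T" and p: "2 < p" and K: "\<And>N. 0 < N \<Longrightarrow> N \<le> K N"
  shows "AE \<omega> in M. \<exists>C. \<forall>N k l. 0 < N \<longrightarrow> k < l \<longrightarrow> l \<le> N \<longrightarrow>
    \<bar>(riemann_diff T (K N) N (\<lambda>t. W t \<omega>) (grid T N l) - riemann_diff T (K N) N (\<lambda>t. W t \<omega>) (grid T N k)) $ x $ y\<bar>
      \<le> C * (real N powr (1 / 2 - 2 / p) * sqrt (grid T N l - grid T N k))"
proof -
  have gap: "0 < 2 - 4 / p" using p by (simp add: field_simps)
  obtain q :: nat where "4 / (2 - 4 / p) < real q" using reals_Archimedean2 by blast
  then have q4: "4 \<le> (2 - 4 / p) * real q" using gap by (simp add: field_simps)
  then have q: "0 < q" by (cases q) auto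
  define B where "B = 8 * real q * moment_const q * T"
  have B: "0 \<le> B" using T by (simp add: B_def moment_const_def)
  define sc where "sc N k l = real N powr (1 / 2 - 2 / p) * sqrt (grid T N l - grid T N k)" for N k l
  define D where "D N k l \<omega> = (riemann_diff T (K N) N (\<lambda>t. W t \<omega>) (grid T N l)
      - riemann_diff T (K N) N (\<lambda>t. W t \<omega>) (grid T N k)) $ x $ y" for N k l \<omega>
  define I where "I n = {(k, l). k < l \<and> l \<le> Suc n}" for n
  have I_sub: "I n \<subseteq> {..<Suc n} \<times> {1..Suc n}" for n by (auto simp: I_def)
  have "AE \<omega> in M. \<exists>C. \<forall>n. \<forall>i\<in>I n. \<bar>case i of (k, l) \<Rightarrow> D (Suc n) k l \<omega> / sc (Suc n) k l\<bar> \<le> C"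
  proof (rule AE_bounded_if_summable_moments[where q = q and b = "\<lambda>n. B ^ q * inverse (real (Suc n) ^ 4)"])
    show "finite (I n)" for n using finite_subset[OF I_sub] by simp
    show "0 < q" by (rule q)
    fix n i assume "i \<in> I n"
    then obtain k l where i: "i = (k, l)" and kl: "k < l" "l \<le> Suc n" by (auto simp: I_def)
    let ?N = "Suc n"
    define r where "r = grid T ?N l - grid T ?N k"
    have r: "0 < r" using kl T by (simp add: r_def grid_def divide_strict_right_mono)
    have N: "0 < ?N" "?N \<le> K ?N" using K by auto
    note m = riemann_diff_moment[OF T N kl q, of x y, folded D_def r_def B_def]
    have pw: "(case i of (k, l) \<Rightarrow> D ?N k l \<omega> / sc ?N k l) ^ (2 * q) = D ?N k l \<omega> ^ (2 * q) / sc ?N k l ^ (2 * q)" for \<omega>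
      by (simp add: i power_divide)
    show "integrable M (\<lambda>\<omega>. (case i of (k, l) \<Rightarrow> D ?N k l \<omega> / sc ?N k l) ^ (2 * q))"
      unfolding pw using m(1) by simp
    have "sc ?N k l ^ (2 * q) = (real ?N powr (1 / 2 - 2 / p)) ^ (2 * q) * r ^ q"
      using r by (simp add: sc_def r_def[symmetric] power_mult_distrib sqrt_power_double)
    also have "(real ?N powr (1 / 2 - 2 / p)) ^ (2 * q) = (real ?N powr (1 - 4 / p)) ^ q"
      unfolding power_mult by (simp add: power2_eq_square powr_add[symmetric])
    finally have sc: "sc ?N k l ^ (2 * q) = (real ?N powr (1 - 4 / p) * r) ^ q"
      by (simp add: power_mult_distrib)
    have "expectation (\<lambda>\<omega>. (case i of (k, l) \<Rightarrow> D ?N k l \<omega> / sc ?N k l) ^ (2 * q))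
        = expectation (\<lambda>\<omega>. D ?N k l \<omega> ^ (2 * q)) / sc ?N k l ^ (2 * q)"
      unfolding pw by simp
    also have "\<dots> \<le> (B * (r / real ?N)) ^ q / (real ?N powr (1 - 4 / p) * r) ^ q"
      unfolding sc using m(2) r by (intro divide_right_mono) auto
    also have "\<dots> = (B * (1 / (real ?N powr 1 * real ?N powr (1 - 4 / p)))) ^ q"
    proof -
      have "B * (r / x) / (y * r) = B * (1 / (x powr 1 * y))" if "0 < x" for x y
        using r that by simp
      then show ?thesis unfolding power_divide[symmetric] by simp
    qed
    also have "\<dots> = B ^ q * (1 / real ?N powr (2 - 4 / p)) ^ q"
      by (simp only: powr_add[symmetric] power_mult_distrib) simp
    also have "(1 / real ?N powr (2 - 4 / p)) ^ q = 1 / real ?N powr ((2 - 4 / p) * real q)"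
      by (simp add: power_divide powr_power mult.commute)
    also have "\<dots> \<le> 1 / real ?N powr 4"
      using q4 by (intro divide_left_mono powr_mono) auto
    also have "1 / real ?N powr 4 = inverse (real ?N ^ 4)"
      by (simp add: inverse_eq_divide)
    finally show "expectation (\<lambda>\<omega>. (case i of (k, l) \<Rightarrow> D ?N k l \<omega> / sc ?N k l) ^ (2 * q)) \<le> B ^ q * inverse (real ?N ^ 4)"
      using B by (simp add: mult_left_mono)
  next
    have "summable (\<lambda>n. B ^ q * inverse (real (Suc n) ^ 2))"
      by (intro summable_mult inverse_power_summable[THEN summable_Suc_iff[THEN iffD2]]) simp
    then show "summable (\<lambda>n. real (card (I n)) * (B ^ q * inverse (real (Suc n) ^ 4)))"
    proof (rule summable_comparison_test'[where N = 0])
      fix n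
      have "card (I n) \<le> card ({..<Suc n} \<times> {1..Suc n})" using I_sub by (intro card_mono) auto
      then have "card (I n) \<le> (Suc n)\<^sup>2" by (simp add: card_cartesian_product power2_eq_square)
      from of_nat_mono[OF this] have "real (card (I n)) \<le> real (Suc n) ^ 2" by (simp only: of_nat_power)
      then have "real (card (I n)) * (B ^ q * inverse (real (Suc n) ^ 4)) \<le> real (Suc n) ^ 2 * (B ^ q * inverse (real (Suc n) ^ 4))"
        using B by (intro mult_right_mono) auto
      also have "\<dots> = B ^ q * inverse (real (Suc n) ^ 2)"
        by (simp add: field_simps power2_eq_square power4_eq_xxxx del: of_nat_Suc)
      finally show "norm (real (card (I n)) * (B ^ q * inverse (real (Suc n) ^ 4))) \<le> B ^ q * inverse (real (Suc n) ^ 2)"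
        using B by simp
    qed
  qed
  then show ?thesis
  proof eventually_elim
    case (elim \<omega>)
    then obtain C where C: "\<And>n i. i \<in> I n \<Longrightarrow> \<bar>case i of (k, l) \<Rightarrow> D (Suc n) k l \<omega> / sc (Suc n) k l\<bar> \<le> C" by blast
    show ?case
    proof (intro exI allI impI)
      fix N k l :: nat assume N: "0 < N" and kl: "k < l" "l \<le> N"
      obtain n where n: "N = Suc n" using N by (cases N) auto
      have "0 < sc N k l"
        using N kl T by (auto simp: sc_def grid_def intro!: mult_pos_pos divide_strict_right_mono)
      moreover have "\<bar>D N k l \<omega> / sc N k l\<bar> \<le> C" using C[of "(k, l)" n] kl by (simp add: I_def n)
      ultimately have "\<bar>D N k l \<omega>\<bar> \<le> C * sc N k l" by (simp add: pos_divide_le_eq)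
      then show "\<bar>(riemann_diff T (K N) N (\<lambda>t. W t \<omega>) (grid T N l)
          - riemann_diff T (K N) N (\<lambda>t. W t \<omega>) (grid T N k)) $ x $ y\<bar>
        \<le> C * (real N powr (1 / 2 - 2 / p) * sqrt (grid T N l - grid T N k))"
        by (simp only: D_def sc_def)
    qed
  qed
qed

lemma AE_riemann_diff_bound:
  assumes T: "0 < T" and p: "2 < p" and K: "\<And>N. 0 < N \<Longrightarrow> N \<le> K N"
  shows "AE \<omega> in M. \<exists>C\<ge>0. \<forall>N k l. 0 < N \<longrightarrow> k \<le> l \<longrightarrow> l \<le> N \<longrightarrow>
    norm (riemann_diff T (K N) N (\<lambda>t. W t \<omega>) (grid T N l) - riemann_diff T (K N) N (\<lambda>t. W t \<omega>) (grid T N k))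
      \<le> C * real N powr (1 / 2 - 2 / p) * sqrt (grid T N l - grid T N k)"
proof -
  have "AE \<omega> in M. \<forall>x y. \<exists>C. \<forall>N k l. 0 < N \<longrightarrow> k < l \<longrightarrow> l \<le> N \<longrightarrow>
    \<bar>(riemann_diff T (K N) N (\<lambda>t. W t \<omega>) (grid T N l) - riemann_diff T (K N) N (\<lambda>t. W t \<omega>) (grid T N k)) $ x $ y\<bar>
      \<le> C * (real N powr (1 / 2 - 2 / p) * sqrt (grid T N l - grid T N k))"
    by (intro AE_UNIV_finite AE_riemann_diff_component_bound T p K)
  then show ?thesis
  proof eventually_elim
    case (elim \<omega>)
    then obtain C where C: "\<And>x y N k l. 0 < N \<Longrightarrow> k < l \<Longrightarrow> l \<le> N \<Longrightarrow>
      \<bar>(riemann_diff T (K N) N (\<lambda>t. W t \<omega>) (grid T N l) - riemann_diff T (K N) N (\<lambda>t. W t \<omega>) (grid T N k)) $ x $ y\<bar>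
      \<le> C x y * (real N powr (1 / 2 - 2 / p) * sqrt (grid T N l - grid T N k))"
      by metis
    define C' where "C' = (\<Sum>x\<in>UNIV. \<Sum>y\<in>UNIV. \<bar>C x y\<bar>)"
    have "norm (riemann_diff T (K N) N (\<lambda>t. W t \<omega>) (grid T N l) - riemann_diff T (K N) N (\<lambda>t. W t \<omega>) (grid T N k))
      \<le> C' * real N powr (1 / 2 - 2 / p) * sqrt (grid T N l - grid T N k)" (is "norm ?D \<le> _")
      if Nkl: "0 < N" "k \<le> l" "l \<le> N" for N k l
    proof (cases "k = l")
      case False
      let ?sc = "real N powr (1 / 2 - 2 / p) * sqrt (grid T N l - grid T N k)"
      have sc: "0 \<le> ?sc" using grid_mono[of T k l N] T Nkl by simp
      have "norm ?D \<le> (\<Sum>x\<in>UNIV. \<Sum>y\<in>UNIV. \<bar>?D $ x $ y\<bar>)" by (rule norm_matrix_le_l1)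
      also have "\<dots> \<le> (\<Sum>x\<in>UNIV. \<Sum>y\<in>UNIV. \<bar>C x y\<bar> * ?sc)"
      proof (intro sum_mono)
        fix x y
        have "\<bar>?D $ x $ y\<bar> \<le> C x y * ?sc" using C Nkl False by simp
        also have "\<dots> \<le> \<bar>C x y\<bar> * ?sc" using sc by (intro mult_right_mono) auto
        finally show "\<bar>?D $ x $ y\<bar> \<le> \<bar>C x y\<bar> * ?sc" .
      qed
      also have "\<dots> = C' * ?sc" by (simp only: C'_def sum_distrib_right)
      finally show ?thesis by (simp only: mult.assoc)
    qed simp
    moreover have "0 \<le> C'" by (auto simp: C'_def intro!: sum_nonneg)
    ultimately show ?case by blast
  qed
qed

text \<open>
  The \<open>2q\<close>-th moments of the increments, rescaled by \<open>2\<^sup>m\<^sup>/\<^sup>p\<close>, are of the order of 2 to the power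
  \<open>-m q (1 - 2/p)\<close>, and there are \<open>2\<^sup>m\<close> intervals on level \<open>m\<close>, so \<open>q (1 - 2/p) \<ge> 2\<close> suffices.
\<close>

lemma AE_dyadic_increment_bound:
  assumes T: "0 < T" and p: "2 < p"
  shows "AE \<omega> in M. \<exists>C\<ge>0. \<forall>m k. k < 2 ^ m \<longrightarrow>
    norm (W (grid T (2 ^ m) (Suc k)) \<omega> - W (grid T (2 ^ m) k) \<omega>) \<le> C * (2 powr - (1 / p)) ^ m"
proof -
  have gap: "0 < 1 - 2 / p" using p by (simp add: field_simps)
  obtain q :: nat where "2 / (1 - 2 / p) < real q" using reals_Archimedean2 by blast
  then have q2: "2 \<le> (1 - 2 / p) * real q" using gap by (simp add: field_simps)
  then have q: "0 < q" by (cases q) auto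
  define a :: real where "a = 2 powr - (1 / p)"
  have a: "0 < a" by (simp add: a_def)
  have ratio: "(1 / (2 * a\<^sup>2)) ^ q \<le> 1 / 4"
  proof -
    have "1 / (2 * a\<^sup>2) = 2 powr - (1 - 2 / p)"
    proof -
      have "2 * a\<^sup>2 = 2 powr 1 * (2 powr - (1 / p) * 2 powr - (1 / p))" by (simp add: a_def power2_eq_square)
      also have "\<dots> = 2 powr (1 - 2 / p)" unfolding powr_add[symmetric] by simp
      finally show ?thesis by (simp only: powr_minus_divide)
    qed
    then have "(1 / (2 * a\<^sup>2)) ^ q = 2 powr (- ((1 - 2 / p) * real q))"
      by (simp add: powr_power algebra_simps)
    also have "\<dots> \<le> 2 powr (-2)" using q2 by (intro powr_mono) auto
    also have "\<dots> = 1 / 4" by (simp add: powr_minus_divide)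
    finally show ?thesis .
  qed
  define c where "c = moment_const q"
  have c: "1 \<le> c" by (simp add: c_def moment_const_def)
  have comp: "AE \<omega> in M. \<exists>C. \<forall>m. \<forall>k\<in>{..<2 ^ m}. \<bar>(W (grid T (2 ^ m) (Suc k)) \<omega> - W (grid T (2 ^ m) k) \<omega>) $ i / a ^ m\<bar> \<le> C" for i
  proof (rule AE_bounded_if_summable_moments[where q = q and b = "\<lambda>m. (c * T) ^ q * (1 / 4) ^ m"])
    show "0 < q" by (rule q)
    fix m k :: nat assume k: "k \<in> {..<2 ^ m}"
    have in_T: "grid T (2 ^ m) k \<in> {0..T}" "grid T (2 ^ m) (Suc k) \<in> {0..T}"
      using grid_in[of T k "2 ^ m"] grid_in[of T "Suc k" "2 ^ m"] T k by auto
    note mo = increment_moment[OF in_T q, of i]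
    have gd: "grid T (2 ^ m) (Suc k) - grid T (2 ^ m) k = T / 2 ^ m" by (simp add: grid_diff)
    show "integrable M (\<lambda>\<omega>. ((W (grid T (2 ^ m) (Suc k)) \<omega> - W (grid T (2 ^ m) k) \<omega>) $ i / a ^ m) ^ (2 * q))"
      unfolding power_divide[of _ "a ^ m"] using mo(1) by simp
    have "expectation (\<lambda>\<omega>. ((W (grid T (2 ^ m) (Suc k)) \<omega> - W (grid T (2 ^ m) k) \<omega>) $ i / a ^ m) ^ (2 * q))
      = expectation (\<lambda>\<omega>. ((W (grid T (2 ^ m) (Suc k)) \<omega> - W (grid T (2 ^ m) k) \<omega>) $ i) ^ (2 * q)) / (a ^ m) ^ (2 * q)"
      unfolding power_divide[of _ "a ^ m"] by simp
    also have "\<dots> \<le> (c * (T / 2 ^ m)) ^ q / (a ^ m) ^ (2 * q)"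
      using mo(2) a T unfolding gd c_def by (intro divide_right_mono) auto
    also have "\<dots> = (c * T) ^ q * ((1 / (2 * a\<^sup>2)) ^ q) ^ m"
      using a by (simp add: power_mult_distrib power_divide field_simps flip: power_mult)
    also have "\<dots> \<le> (c * T) ^ q * (1 / 4) ^ m"
      using ratio a c T by (intro mult_left_mono power_mono) auto
    finally show "expectation (\<lambda>\<omega>. ((W (grid T (2 ^ m) (Suc k)) \<omega> - W (grid T (2 ^ m) k) \<omega>) $ i / a ^ m) ^ (2 * q))
      \<le> (c * T) ^ q * (1 / 4) ^ m" .
  next
    have sm: "summable (\<lambda>m. (c * T) ^ q * (1 / 2) ^ m)" by (intro summable_mult summable_geometric) simp
    have card: "real (card {..<2 ^ m :: nat}) * ((c * T) ^ q * (1 / 4) ^ m) = (c * T) ^ q * (1 / 2) ^ m" for m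
    proof -
      have "(2::real) ^ m * (1 / 4) ^ m = (1 / 2) ^ m" unfolding power_mult_distrib[symmetric] by simp
      then show ?thesis by (simp add: mult.left_commute)
    qed
    show "summable (\<lambda>m. real (card {..<2 ^ m :: nat}) * ((c * T) ^ q * (1 / 4) ^ m))"
      unfolding card by (rule sm)
  qed simp
  have "AE \<omega> in M. \<forall>i. \<exists>C. \<forall>m. \<forall>k\<in>{..<2 ^ m}. \<bar>(W (grid T (2 ^ m) (Suc k)) \<omega> - W (grid T (2 ^ m) k) \<omega>) $ i / a ^ m\<bar> \<le> C"
    by (rule AE_UNIV_finite, rule comp)
  then show ?thesis
  proof eventually_elim
    case (elim \<omega>)
    from choice[OF this]
    obtain C where "\<forall>i m. \<forall>k\<in>{..<2 ^ m}. \<bar>(W (grid T (2 ^ m) (Suc k)) \<omega> - W (grid T (2 ^ m) k) \<omega>) $ i / a ^ m\<bar> \<le> C i"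
      by blast
    then have C: "\<bar>(W (grid T (2 ^ m) (Suc k)) \<omega> - W (grid T (2 ^ m) k) \<omega>) $ i / a ^ m\<bar> \<le> C i" if "k < 2 ^ m" for i m k
      using that by simp
    define C' where "C' = (\<Sum>i\<in>UNIV. \<bar>C i\<bar>)"
    have "norm (W (grid T (2 ^ m) (Suc k)) \<omega> - W (grid T (2 ^ m) k) \<omega>) \<le> C' * a ^ m" (is "norm ?D \<le> _")
      if "k < 2 ^ m" for m k
    proof -
      have "norm ?D \<le> (\<Sum>i\<in>UNIV. \<bar>?D $ i\<bar>)" by (rule norm_le_l1_cart)
      also have "\<dots> \<le> (\<Sum>i\<in>UNIV. \<bar>C i\<bar> * a ^ m)"
      proof (intro sum_mono)
        fix i
        have "\<bar>?D $ i\<bar> \<le> C i * a ^ m" using C[OF that, of i] a by (simp add: pos_divide_le_eq)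
        also have "\<dots> \<le> \<bar>C i\<bar> * a ^ m" using a by (intro mult_right_mono) auto
        finally show "\<bar>?D $ i\<bar> \<le> \<bar>C i\<bar> * a ^ m" .
      qed
      also have "\<dots> = C' * a ^ m" by (simp only: C'_def sum_distrib_right)
      finally show ?thesis .
    qed
    moreover have "0 \<le> C'" by (auto simp: C'_def intro!: sum_nonneg)
    ultimately show ?case unfolding a_def by blast
  qed
qed

lemma AE_area_regular_path:
  assumes T: "0 < T" and p: "2 < p" "p < 3"
  shows "AE \<omega> in M. \<exists>C. area_regular_path T p C (\<lambda>t. W t \<omega>)"
proof -
  have "\<And>N :: nat. N \<le> 2 * N" "\<And>N :: nat. N \<le> 2 ^ N" by (auto intro: less_imp_le)
  note AE_riemann_diff_bound[OF T p(1) this(1)] AE_riemann_diff_bound[OF T p(1) this(2)]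
    AE_dyadic_increment_bound[OF T p(1)] continuous_paths
  then show ?thesis
  proof eventually_elim
    case (elim \<omega>)
    obtain C1 where C1: "0 \<le> C1" "\<forall>N k l. 0 < N \<longrightarrow> k \<le> l \<longrightarrow> l \<le> N \<longrightarrow>
      norm (riemann_diff T (2 * N) N (\<lambda>t. W t \<omega>) (grid T N l) - riemann_diff T (2 * N) N (\<lambda>t. W t \<omega>) (grid T N k))
      \<le> C1 * real N powr (1 / 2 - 2 / p) * sqrt (grid T N l - grid T N k)"
      using elim(1) by blast
    obtain C2 where C2: "0 \<le> C2" "\<forall>N k l. 0 < N \<longrightarrow> k \<le> l \<longrightarrow> l \<le> N \<longrightarrow>
      norm (riemann_diff T (2 ^ N) N (\<lambda>t. W t \<omega>) (grid T N l) - riemann_diff T (2 ^ N) N (\<lambda>t. W t \<omega>) (grid T N k))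
      \<le> C2 * real N powr (1 / 2 - 2 / p) * sqrt (grid T N l - grid T N k)"
      using elim(2) by blast
    obtain C3 where C3: "0 \<le> C3" "\<forall>m k. k < 2 ^ m \<longrightarrow>
      norm (W (grid T (2 ^ m) (Suc k)) \<omega> - W (grid T (2 ^ m) k) \<omega>) \<le> C3 * (2 powr - (1 / p)) ^ m"
      using elim(3) by blast
    define C where "C = C1 + C2 + C3"
    have C: "0 \<le> C" "C1 \<le> C" "C2 \<le> C" "C3 \<le> C" using C1(1) C2(1) C3(1) by (auto simp: C_def)
    have "area_regular_path T p C (\<lambda>t. W t \<omega>)"
    proof
      show "norm (W (grid T (2 ^ m) (Suc k)) \<omega> - W (grid T (2 ^ m) k) \<omega>) \<le> C * (2 powr - (1 / p)) ^ m"
        if "k < 2 ^ m" for m k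
        using C3(2)[rule_format, OF that] by (rule order.trans) (intro mult_right_mono C, simp)
      fix N k l :: nat assume Nkl: "0 < N" "k \<le> l" "l \<le> N"
      have sc: "0 \<le> sqrt (grid T N l - grid T N k)" using grid_mono[of T k l N] T Nkl by simp
      show "norm (riemann_diff T (2 * N) N (\<lambda>t. W t \<omega>) (grid T N l) - riemann_diff T (2 * N) N (\<lambda>t. W t \<omega>) (grid T N k))
        \<le> C * real N powr (1 / 2 - 2 / p) * sqrt (grid T N l - grid T N k)"
        using C1(2)[rule_format, OF Nkl] by (rule order.trans) (intro mult_right_mono C sc, simp)
      show "norm (riemann_diff T (2 ^ N) N (\<lambda>t. W t \<omega>) (grid T N l) - riemann_diff T (2 ^ N) N (\<lambda>t. W t \<omega>) (grid T N k))
        \<le> C * real N powr (1 / 2 - 2 / p) * sqrt (grid T N l - grid T N k)"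
        using C2(2)[rule_format, OF Nkl] by (rule order.trans) (intro mult_right_mono C sc, simp)
    qed (use T p C elim(4) in auto)
    then show ?case by blast
  qed
qed

end

text \<open>
  Eventually \<open>ln n \<ge> 1\<close>, so the given null sequence dominates the powers of \<open>h\<close>.
\<close>

lemma steps_tendsto_0:
  fixes h :: "nat \<Rightarrow> real"
  assumes h: "\<And>n. 0 < h n" and a: "0 < a" and lim: "(\<lambda>n. h n powr a * ln (real n)) \<longlonglongrightarrow> 0"
  shows "h \<longlonglongrightarrow> 0"
proof -
  have "(\<lambda>n. h n powr a) \<longlonglongrightarrow> 0"
  proof (rule tendsto_sandwich[OF _ _ tendsto_const lim])
    have "\<forall>\<^sub>F n in sequentially. 1 \<le> ln (real n)"
      using filterlim_compose[OF ln_at_top filterlim_real_sequentially] by (auto simp: filterlim_at_top)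
    then show "\<forall>\<^sub>F n in sequentially. h n powr a \<le> h n powr a * ln (real n)"
      by eventually_elim (simp add: mult_le_cancel_left1)
  qed simp
  then have "(\<lambda>n. (h n powr a) powr (1 / a)) \<longlonglongrightarrow> 0 powr (1 / a)"
    using a by (intro tendsto_powr' tendsto_const) auto
  then show ?thesis using h a by (simp add: powr_powr less_imp_le)
qed

theorem proposition3p2:
  fixes M :: "'a measure" and F :: "real \<Rightarrow> 'a measure" and W :: "real \<Rightarrow> 'a \<Rightarrow> real ^ 'd"
    and T p :: real and N :: "nat \<Rightarrow> nat" and \<tau> :: "nat \<Rightarrow> nat \<Rightarrow> real" and \<pi> :: "nat \<Rightarrow> real"
  assumes "0 < T"
    and "brownian_motion M T F W"
    and "2 < p" and "p < 3"
    and "\<And>n. is_partition T (N n) (\<tau> n)"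
    and "\<And>n. 0 < \<pi> n"
    and "\<And>n i. i < N n \<Longrightarrow> \<tau> n (Suc i) - \<tau> n i = \<pi> n"
    and "(\<lambda>n. \<pi> n powr (2 - 4 / p) * ln (real n)) \<longlonglongrightarrow> 0"
  shows "AE \<omega> in M. property_RIE T p N \<tau> (\<lambda>t. W t \<omega>)"
proof -
  interpret brownian_motion M T F W by (rule assms(2))
  have "0 < 2 - 4 / p" using assms(3) by (simp add: field_simps)
  note lim = steps_tendsto_0[OF assms(6) this assms(8)]
  from AE_area_regular_path[OF assms(1,3,4)] show ?thesis
  proof eventually_elim
    case (elim \<omega>)
    then obtain C where "area_regular_path T p C (\<lambda>t. W t \<omega>)" ..
    from area_regular_path.property_RIE_uniform_partitions[OF this assms(5) assms(7) lim]
    show ?case .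
  qed
qed

end
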